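(* Let $V\in L^\infty(\mathbb{R})$ satisfy $0<v_0\le V(x)\le v_1$ for a.e. $x\in\mathbb{R}$, for some constants $v_0,v_1$, and fix $a\in\mathbb{R}$. Then there exists a unique minimizer $u_a\in K_a$ of $\|u\|_V^2$ over $u\in K_a$, i.e. a unique $u_a\in K_a$ with $$F(a)=\min_{u\in K_a}\|u\|_V^2=\|u_a\|_V^2,$$ and it satisfies the following properties: 1. $u_a\in W^{2,\infty}(\mathbb{R}\setminus\{a\})$ and $u_a''(x)=V(x)u_a(x)$ for a.e. $x\in\mathbb{R}\setminus\{a\}$; 2. $e^{-\sqrt{v_1}|x-a|}\le u_a(x)\le e^{-\sqrt{v_0}|x-a|}$ for all $x\in\mathbb{R}$; 3. $\dfrac{v_0}{\sqrt{v_1}}e^{-\sqrt{v_1}|x-a|}\le \mathrm{sgn}(a-x)\,u_a'(x)\le \dfrac{v_1}{\sqrt{v_0}}e^{-\sqrt{v_0}|x-a|}$ for all $x\in\mathbb{R}\setminus\{a\}$. In particular, when $V$ is a positive constant (i.e. $v_0=V=v_1$), then $u_a(x)=e^{-\sqrt{V}|x-a|}$ for all $x\in\mathbb{R}$.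
   Context: All function spaces are real-valued, $H^1(\mathbb{R})=W^{1,2}(\mathbb{R})$, and every $u\in H^1(\mathbb{R})$ is identified with its continuous representative (similarly, functions in $W^{2,\infty}(\mathbb{R}\setminus\{a\})$ are identified with their $C^1$ representatives on $\mathbb{R}\setminus\{a\}$). Write $\|u\|_\infty=\|u\|_{L^\infty(\mathbb{R})}$ and $$\|u\|_V^2=\int_{\mathbb{R}}\left(|u'(x)|^2+V(x)|u(x)|^2\right)dx .$$ For $a\in\mathbb{R}$ set $K_a:=\{u\in H^1(\mathbb{R}):\ u(a)=\|u\|_\infty=1\}$ and $F(a):=\inf_{u\in K_a}\|u\|_V^2$. *)

theory Defs
  imports "HOL-Probability.Probability"
begin

(* Meaningful for 1 <= p <= \<infinity>. *)
definition Lp :: "ereal \<Rightarrow> real set \<Rightarrow> (real \<Rightarrow> real) set" where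
  "Lp p \<Omega> = {f \<in> borel_measurable (lebesgue_on \<Omega>).
     if p = \<infinity> then esssup (lebesgue_on \<Omega>) (\<lambda>x. ereal \<bar>f x\<bar>) < \<infinity>
     else integrable (lebesgue_on \<Omega>) (\<lambda>x. \<bar>f x\<bar> powr real_of_ereal p)}"

definition Linf_norm :: "(real \<Rightarrow> real) \<Rightarrow> ereal" where
  "Linf_norm f = esssup lebesgue (\<lambda>x. ereal \<bar>f x\<bar>)"

definition locally_integrable :: "real set \<Rightarrow> (real \<Rightarrow> real) \<Rightarrow> bool" where
  "locally_integrable \<Omega> f \<longleftrightarrow> (\<forall>C. compact C \<and> C \<subseteq> \<Omega> \<longrightarrow> f absolutely_integrable_on C)"

definition test_functions :: "real set \<Rightarrow> (real \<Rightarrow> real) set" where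
  "test_functions \<Omega> = {\<phi>. (\<forall>n x. (deriv ^^ n) \<phi> differentiable (at x)) \<and>
     compact (closure {x. \<phi> x \<noteq> 0}) \<and> closure {x. \<phi> x \<noteq> 0} \<subseteq> \<Omega>}"

definition has_weak_deriv :: "nat \<Rightarrow> real set \<Rightarrow> (real \<Rightarrow> real) \<Rightarrow> (real \<Rightarrow> real) \<Rightarrow> bool" where
  "has_weak_deriv k \<Omega> u g \<longleftrightarrow> locally_integrable \<Omega> u \<and> locally_integrable \<Omega> g \<and>
     (\<forall>\<phi>\<in>test_functions \<Omega>.
        (LINT x|lebesgue_on \<Omega>. u x * (deriv ^^ k) \<phi> x) =
        (-1) ^ k * (LINT x|lebesgue_on \<Omega>. g x * \<phi> x))"

(* Weak derivatives on open sets are determined almost everywhere; this is some representative. *)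
definition weak_deriv :: "nat \<Rightarrow> real set \<Rightarrow> (real \<Rightarrow> real) \<Rightarrow> real \<Rightarrow> real" where
  "weak_deriv k \<Omega> u = (SOME g. has_weak_deriv k \<Omega> u g)"

definition sobolev :: "nat \<Rightarrow> ereal \<Rightarrow> real set \<Rightarrow> (real \<Rightarrow> real) set" where
  "sobolev k p \<Omega> = {u \<in> Lp p \<Omega>. \<forall>j\<in>{1..k}. \<exists>g\<in>Lp p \<Omega>. has_weak_deriv j \<Omega> u g}"

(* H1 and W2inf consist of the distinguished representatives (continuous, respectively C1 on
   the open set), so that point values and equality of functions are meaningful.
   The values of u in W2inf S outside S are irrelevant. *)
definition H1 :: "(real \<Rightarrow> real) set" where
  "H1 = {u \<in> sobolev 1 2 UNIV. continuous_on UNIV u}"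

definition W2inf :: "real set \<Rightarrow> (real \<Rightarrow> real) set" where
  "W2inf \<Omega> = {u \<in> sobolev 2 \<infinity> \<Omega>. u C1_differentiable_on \<Omega>}"

(* The integrand is integrable for u in H1 and V essentially bounded, so the convention that
   non-integrable functions have integral 0 plays no role there. *)
definition energy :: "(real \<Rightarrow> real) \<Rightarrow> (real \<Rightarrow> real) \<Rightarrow> real" where
  "energy V u = (LINT x|lebesgue. \<bar>weak_deriv 1 UNIV u x\<bar>\<^sup>2 + V x * \<bar>u x\<bar>\<^sup>2)"

definition K :: "real \<Rightarrow> (real \<Rightarrow> real) set" where
  "K a = {u \<in> H1. ereal (u a) = Linf_norm u \<and> Linf_norm u = 1}"

definition F :: "(real \<Rightarrow> real) \<Rightarrow> real \<Rightarrow> real" where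
  "F V a = (INF u\<in>K a. energy V u)"

end

theory Submission
  imports Defs
begin

text \<open>
  The minimizer is constructed first and then compared with all competitors.  On the right of \<open>a\<close> it
  has the form u(x) = exp(-P(x)), where P vanishes at \<open>a\<close> and
  p = P' solves the Riccati equation p' = p^2 - V; this equation is equivalent to u'' = V u.
  Looking for a solution p which is bounded on the whole line turns the Riccati equation into a
  fixed point problem
    p(x) = \<integral> over y \<ge> x of exp(-c(y - x)) (V(y) + c p(y) - p(y)^2) dy,
  and for c = 2 sqrt(v1) the right-hand side maps the functions with values in
  [sqrt(v0), sqrt(v1)] to themselves and is a contraction (\<open>riccati_solution\<close>).  The bounds on p are
  all that the estimates require: integrating them gives the exponential bounds on u, and
  u' = -p u gives those on the derivative.  The left of \<open>a\<close> is treated by reflection.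

  Let g be the derivative of this u and let w be any competitor, h = w - u and k = h'.  The energy
  is quadratic and splits as
    energy w = energy u + 2 \<integral> (g k + V u h) + \<integral> (k^2 + V h^2).
  On each side of \<open>a\<close> the integrand of the mixed term is the derivative of g h.  The function g jumps
  at \<open>a\<close>, but h(a) = 0, and g h vanishes at infinity; hence the mixed term is zero.  Since V is
  positive, u is the only minimizer (\<open>constrained_minimizer\<close>).  For constant V the upper and the lower
  bound coincide when both constants are chosen equal to V.

  The competitor is given only by its weak derivative, so the computation needs that a continuous
  function is the integral of its weak derivative (\<open>du_Bois_Reymond\<close>), that weak derivatives are unique
  (\<open>fundamental_lemma_of_calculus_of_variations\<close>, from explicit smooth cut-off functions), and a product
  rule for indefinite integrals (\<open>primitive_of_mult\<close>).
\<close>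


section \<open>Functions recovered from an integrable derivative\<close>

text \<open>
  Equivalently, P is locally absolutely continuous with derivative f almost everywhere.  The integral
  form determines f only up to null sets, which is the right notion for weak derivatives.
\<close>

definition primitive_of :: "(real \<Rightarrow> real) \<Rightarrow> (real \<Rightarrow> real) \<Rightarrow> bool" where
  "primitive_of P f \<longleftrightarrow> (\<forall>x y. f absolutely_integrable_on {x..y}) \<and>
     (\<forall>x y. x \<le> y \<longrightarrow> integral {x..y} f = P y - P x)"

lemma primitive_ofD:
  assumes "primitive_of P f"
  shows "f absolutely_integrable_on {x..y}" "f integrable_on {x..y}"
    and "x \<le> y \<Longrightarrow> integral {x..y} f = P y - P x"
proof -
  show *: "f absolutely_integrable_on {x..y}"
    using assms unfolding primitive_of_def by blast
  show "f integrable_on {x..y}"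
    by (rule set_lebesgue_integral_eq_integral(1)[OF *])
  show "x \<le> y \<Longrightarrow> integral {x..y} f = P y - P x"
    using assms unfolding primitive_of_def by blast
qed

lemma primitive_of_continuous:
  assumes "primitive_of P f"
  shows "continuous_on UNIV P"
proof -
  have "isCont P x" for x
  proof -
    have "continuous_on {x-1..x+1} (\<lambda>y. integral {x-1..y} f)"
      by (rule indefinite_integral_continuous_1) (rule primitive_ofD[OF assms])
    then have "continuous_on {x-1..x+1} (\<lambda>y. P (x-1) + integral {x-1..y} f)"
      by (intro continuous_intros)
    then have "continuous_on {x-1..x+1} P"
      by (rule continuous_on_eq) (simp add: primitive_ofD(3)[OF assms])
    then show ?thesis
      by (rule continuous_on_interior) simp
  qed
  then show ?thesis
    by (simp add: continuous_at_imp_continuous_on)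
qed

lemma primitive_of_diff:
  assumes "primitive_of P f" "primitive_of Q g"
  shows "primitive_of (\<lambda>x. P x - Q x) (\<lambda>x. f x - g x)"
  unfolding primitive_of_def
proof (intro conjI allI impI)
  fix x y :: real
  show "(\<lambda>x. f x - g x) absolutely_integrable_on {x..y}"
    by (intro set_integral_diff(1) primitive_ofD[OF assms(1)] primitive_ofD[OF assms(2)])
  assume "x \<le> y"
  then show "integral {x..y} (\<lambda>x. f x - g x) = P y - Q y - (P x - Q x)"
    by (subst Henstock_Kurzweil_Integration.integral_diff)
       (auto simp: primitive_ofD[OF assms(1)] primitive_ofD[OF assms(2)])
qed

lemma primitive_of_C1:
  assumes "\<And>x. (P has_real_derivative f x) (at x)" "continuous_on UNIV f"
  shows "primitive_of P f"
  unfolding primitive_of_def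
proof (intro conjI allI impI)
  fix x y :: real
  show "f absolutely_integrable_on {x..y}"
    using assms(2) continuous_on_subset by (intro absolutely_integrable_continuous_real) blast
  assume "x \<le> y"
  then have "(f has_integral (P y - P x)) {x..y}"
    by (intro fundamental_theorem_of_calculus)
       (auto intro: assms(1)[THEN has_field_derivative_at_within] simp flip: has_real_derivative_iff_has_vector_derivative)
  then show "integral {x..y} f = P y - P x"
    by (rule integral_unique)
qed

lemma absolutely_integrable_continuous_mult:
  fixes P g :: "real \<Rightarrow> real"
  assumes "continuous_on UNIV P" "g absolutely_integrable_on {x..y}"
  shows "(\<lambda>t. P t * g t) absolutely_integrable_on {x..y}"
proof (rule absolutely_integrable_bounded_measurable_product_real)
  have c: "continuous_on {x..y} P"
    using assms(1) continuous_on_subset by blast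
  show "P \<in> borel_measurable (lebesgue_on {x..y})"
    by (rule continuous_imp_measurable_on_sets_lebesgue[OF c]) simp
  show "bounded (P ` {x..y})"
    by (intro compact_imp_bounded compact_continuous_image c compact_Icc)
qed (use assms in auto)

text \<open>
  Integration by parts for absolutely continuous functions.  The defect
  D(x,y) of the claimed identity on [x,y] is additive in the interval, and on a short interval
    D(x,y) = \<integral> (P(y) - P(s)) g(s) + (Q(x) - Q(s)) f(s) ds,
  so continuity of P and Q makes it at most e times the integral of |f| + |g|.  Additivity
  propagates this bound from short intervals to all intervals, with e arbitrary.
\<close>

lemma primitive_of_mult:
  assumes P: "primitive_of P f" and Q: "primitive_of Q g"
  shows "primitive_of (\<lambda>x. P x * Q x) (\<lambda>x. P x * g x + Q x * f x)"
  unfolding primitive_of_def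
proof (intro conjI allI impI)
  have cF: "continuous_on UNIV P" and cG: "continuous_on UNIV Q"
    using P Q primitive_of_continuous by blast+
  have aFg: "(\<lambda>x. P x * g x) absolutely_integrable_on {x..y}"
   and aGf: "(\<lambda>x. Q x * f x) absolutely_integrable_on {x..y}" for x y
    using absolutely_integrable_continuous_mult[OF cF primitive_ofD(1)[OF Q]]
      absolutely_integrable_continuous_mult[OF cG primitive_ofD(1)[OF P]] by auto
  show a: "(\<lambda>x. P x * g x + Q x * f x) absolutely_integrable_on {x..y}" for x y
    by (intro set_integral_add(1) aFg aGf)
  fix x0 y0 :: real assume le0: "x0 \<le> y0"
  define m where "m = (\<lambda>x. \<bar>f x\<bar> + \<bar>g x\<bar>)"
  have mi: "m integrable_on {x..y}" for x y
    unfolding m_def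
    using primitive_ofD(1)[OF P, of x y] primitive_ofD(1)[OF Q, of x y]
    by (auto intro!: integrable_add simp: absolutely_integrable_on_def)
  define D where "D = (\<lambda>x y. P y * Q y - P x * Q x - integral {x..y} (\<lambda>x. P x * g x + Q x * f x))"
  have hi: "(\<lambda>x. P x * g x + Q x * f x) integrable_on {x..y}" for x y
    using a set_lebesgue_integral_eq_integral(1) by blast
  have "\<bar>D x0 y0\<bar> \<le> e * integral {x0..y0} m" if e: "e > 0" for e
    using le0
  proof (induct rule: Bolzano)
    case (trans x y z)
    have "D x z = D x y + D y z"
      using Henstock_Kurzweil_Integration.integral_combine[OF trans(3,4) hi] by (simp add: D_def)
    moreover have "integral {x..z} m = integral {x..y} m + integral {y..z} m"
      using Henstock_Kurzweil_Integration.integral_combine[OF trans(3,4) mi] by simp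
    ultimately show ?case
      using trans(1,2) by (simp add: distrib_left)
  next
    case (local t)
    have "isCont P t" "isCont Q t"
      using cF cG by (auto simp: continuous_on_eq_continuous_at)
    then obtain d1 d2 where d: "d1 > 0" "d2 > 0"
      and d1: "\<And>s. \<bar>s - t\<bar> < d1 \<Longrightarrow> \<bar>P s - P t\<bar> < e/2"
      and d2: "\<And>s. \<bar>s - t\<bar> < d2 \<Longrightarrow> \<bar>Q s - Q t\<bar> < e/2"
      using e unfolding continuous_at_eps_delta
      by (metis dist_real_def half_gt_zero)
    show ?case
    proof (intro exI[of _ "min d1 d2"] conjI allI impI)
      fix x y :: real assume xy: "x \<le> t \<and> t \<le> y \<and> y - x < min d1 d2"
      then have le: "x \<le> y" by simp
      have osc: "\<bar>P y - P s\<bar> \<le> e" "\<bar>Q x - Q s\<bar> \<le> e" if "s \<in> {x..y}" for s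
      proof -
        have "\<bar>s - t\<bar> < d1" "\<bar>y - t\<bar> < d1" "\<bar>s - t\<bar> < d2" "\<bar>x - t\<bar> < d2"
          using that xy by auto
        then show "\<bar>P y - P s\<bar> \<le> e" "\<bar>Q x - Q s\<bar> \<le> e"
          using d1[of s] d1[of y] d2[of s] d2[of x] by linarith+
      qed
      have i1: "(\<lambda>s. P y * g s + Q x * f s) integrable_on {x..y}"
        by (intro integrable_add integrable_on_mult_right primitive_ofD(2)[OF P] primitive_ofD(2)[OF Q])
      \<comment> \<open>The right-hand side is the increment of the product, hence D(x,y) compares coefficients
        fixed at the end points with coefficients that vary.\<close>
      have "integral {x..y} (\<lambda>s. P y * g s + Q x * f s) = P y * (Q y - Q x) + Q x * (P y - P x)"
        using primitive_ofD(3)[OF P le] primitive_ofD(3)[OF Q le]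
        by (subst Henstock_Kurzweil_Integration.integral_add)
           (simp_all add: integrable_on_mult_right[OF primitive_ofD(2)[OF Q]] integrable_on_mult_right[OF primitive_ofD(2)[OF P]])
      then have "D x y = integral {x..y} (\<lambda>s. P y * g s + Q x * f s) - integral {x..y} (\<lambda>x. P x * g x + Q x * f x)"
        by (simp add: D_def algebra_simps)
      also have "\<dots> = integral {x..y} (\<lambda>s. (P y * g s + Q x * f s) - (P s * g s + Q s * f s))"
        by (rule Henstock_Kurzweil_Integration.integral_diff[symmetric]) (rule i1 hi)+
      also have "\<bar>\<dots>\<bar> \<le> integral {x..y} (\<lambda>s. e * m s)"
      proof -
        have "norm (integral {x..y} (\<lambda>s. (P y * g s + Q x * f s) - (P s * g s + Q s * f s)))
               \<le> integral {x..y} (\<lambda>s. e * m s)"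
        proof (rule integral_norm_bound_integral)
          show "(\<lambda>s. (P y * g s + Q x * f s) - (P s * g s + Q s * f s)) integrable_on {x..y}"
            by (intro integrable_diff i1 hi)
          show "(\<lambda>s. e * m s) integrable_on {x..y}"
            by (intro integrable_on_mult_right mi)
          fix s assume s: "s \<in> {x..y}"
          have "(P y * g s + Q x * f s) - (P s * g s + Q s * f s) = (P y - P s) * g s + (Q x - Q s) * f s"
            by (simp add: algebra_simps)
          also have "\<bar>\<dots>\<bar> \<le> \<bar>P y - P s\<bar> * \<bar>g s\<bar> + \<bar>Q x - Q s\<bar> * \<bar>f s\<bar>"
            by (metis abs_mult abs_triangle_ineq)
          also have "\<dots> \<le> e * \<bar>g s\<bar> + e * \<bar>f s\<bar>"
            by (intro add_mono mult_right_mono osc s abs_ge_zero)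
          finally show "norm ((P y * g s + Q x * f s) - (P s * g s + Q s * f s)) \<le> e * m s"
            by (simp add: m_def algebra_simps)
        qed
        then show ?thesis by simp
      qed
      also have "\<dots> = e * integral {x..y} m" by simp
      finally show "\<bar>D x y\<bar> \<le> e * integral {x..y} m" .
    qed (use d in auto)
  qed
  note bound = this
  have "D x0 y0 = 0"
  proof (rule ccontr)
    assume nz: "D x0 y0 \<noteq> 0"
    define I where "I = integral {x0..y0} m"
    have I0: "I \<ge> 0" unfolding I_def m_def
      by (rule Henstock_Kurzweil_Integration.integral_nonneg) (use mi m_def in auto)
    \<comment> \<open>The choice of e keeps e I below half of |D|; adding one covers the case I = 0.\<close>
    have "\<bar>D x0 y0\<bar> \<le> (\<bar>D x0 y0\<bar> / (2 * (I + 1))) * I"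
      using bound[of "\<bar>D x0 y0\<bar> / (2 * (I + 1))"] nz I0 by (simp add: I_def)
    then have "I * \<bar>D x0 y0\<bar> + 2 * \<bar>D x0 y0\<bar> \<le> 0"
      using I0 by (simp add: field_simps)
    moreover have "0 \<le> I * \<bar>D x0 y0\<bar>"
      using I0 by simp
    ultimately show False using nz by linarith
  qed
  then show "integral {x0..y0} (\<lambda>x. P x * g x + Q x * f x) = P y0 * Q y0 - P x0 * Q x0"
    by (simp add: D_def)
qed

text \<open>
  Functions with a kink at \<open>a\<close> are handled by gluing two primitives.  It is applied
  to products whose factors may jump at \<open>a\<close>, as long as the product itself does not.
\<close>

lemma primitive_of_glue:
  fixes Pl Pr l r :: "real \<Rightarrow> real"
  assumes Pl: "primitive_of Pl l" and Pr: "primitive_of Pr r" and a: "Pl a = Pr a"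
  shows "primitive_of (\<lambda>x. if a \<le> x then Pr x else Pl x) (\<lambda>x. if a \<le> x then r x else l x)"
proof -
  let ?f = "\<lambda>x. if a \<le> x then r x else l x"
  let ?P = "\<lambda>x. if a \<le> x then Pr x else Pl x"
  have right: "?f absolutely_integrable_on {x..y} \<and> (x \<le> y \<longrightarrow> integral {x..y} ?f = ?P y - ?P x)" if "a \<le> x" for x y
  proof
    show "?f absolutely_integrable_on {x..y}"
      by (rule absolutely_integrable_spike[OF primitive_ofD(1)[OF Pr] negligible_empty]) (use that in auto)
    have "integral {x..y} ?f = integral {x..y} r"
      by (rule integral_cong) (use that in auto)
    then show "x \<le> y \<longrightarrow> integral {x..y} ?f = ?P y - ?P x"
      using that primitive_ofD(3)[OF Pr, of x y] by auto
  qed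
  have left: "?f absolutely_integrable_on {x..y} \<and> (x \<le> y \<longrightarrow> integral {x..y} ?f = ?P y - ?P x)" if "y \<le> a" for x y
  proof
    show "?f absolutely_integrable_on {x..y}"
      by (rule absolutely_integrable_spike[OF primitive_ofD(1)[OF Pl], of "{a}"]) (use that in auto)
    have "integral {x..y} ?f = integral {x..y} l"
      by (rule integral_spike[of "{a}"]) (use that in auto)
    then show "x \<le> y \<longrightarrow> integral {x..y} ?f = ?P y - ?P x"
      using that primitive_ofD(3)[OF Pl, of x y] a by auto
  qed
  show ?thesis
    unfolding primitive_of_def
  proof (intro conjI allI impI)
    fix x y :: real
    show ai: "?f absolutely_integrable_on {x..y}"
    proof (cases "a \<le> x \<or> y \<le> a")
      case True then show ?thesis by (rule disjE) (rule right[THEN conjunct1] left[THEN conjunct1], assumption)+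
    next
      case False then show ?thesis
        using absolutely_integrable_on_combine[OF left[of a x, THEN conjunct1] right[of a y, THEN conjunct1]] by simp
    qed
    assume le: "x \<le> y"
    show "integral {x..y} ?f = ?P y - ?P x"
    proof (cases "a \<le> x \<or> y \<le> a")
      case True then show ?thesis using left[of y x] right[of x y] le by argo
    next
      case False
      then have "integral {x..a} ?f + integral {a..y} ?f = integral {x..y} ?f"
        by (intro Henstock_Kurzweil_Integration.integral_combine) (use False set_lebesgue_integral_eq_integral(1)[OF ai] in simp_all)
      then show ?thesis
        using False left[of a x] right[of a y] a by auto
    qed
  qed
qed

lemma primitive_of_reflect:
  assumes "primitive_of P f"
  shows "primitive_of (\<lambda>x. P (c - x)) (\<lambda>x. - f (c - x))"
  unfolding primitive_of_def
proof (intro conjI allI impI)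
  fix x y :: real
  have hb: "has_bochner_integral lebesgue (\<lambda>t. indicat_real {c-y..c-x} t *\<^sub>R f t) (integral {c-y..c-x} f)"
    using primitive_ofD(1)[OF assms, of "c-y" "c-x"]
      set_lebesgue_integral_eq_integral(2)[OF primitive_ofD(1)[OF assms, of "c-y" "c-x"]]
    by (simp add: has_bochner_integral_iff set_integrable_def set_lebesgue_integral_def)
  have "has_bochner_integral lebesgue (\<lambda>t. indicat_real {c-y..c-x} (c + -1 * t) *\<^sub>R f (c + -1 * t)) (integral {c-y..c-x} f /\<^sub>R \<bar>-1\<bar>)"
    using hb by (subst has_bochner_integral_lebesgue_real_affine_iff[symmetric]) auto
  moreover have "(\<lambda>t. indicat_real {c-y..c-x} (c + -1 * t) *\<^sub>R f (c + -1 * t)) = (\<lambda>t. indicat_real {x..y} t *\<^sub>R f (c - t))"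
    by (auto simp: fun_eq_iff indicator_def)
  ultimately have hb2: "has_bochner_integral lebesgue (\<lambda>t. indicat_real {x..y} t *\<^sub>R f (c - t)) (integral {c-y..c-x} f)"
    by simp
  then have si: "(\<lambda>t. f (c - t)) absolutely_integrable_on {x..y}"
    by (simp add: set_integrable_def has_bochner_integral_iff)
  then show "(\<lambda>t. - f (c - t)) absolutely_integrable_on {x..y}"
    by (simp add: set_integrable_def)
  assume le: "x \<le> y"
  have "integral {x..y} (\<lambda>t. f (c - t)) = integral {c-y..c-x} f"
    using hb2 set_lebesgue_integral_eq_integral(2)[OF si]
    by (simp add: has_bochner_integral_iff set_lebesgue_integral_def)
  then show "integral {x..y} (\<lambda>t. - f (c - t)) = P (c - y) - P (c - x)"
    using le primitive_ofD(3)[OF assms, of "c-y" "c-x"] by simp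
qed

text \<open>
  Boundary terms at infinity disappear: this is the form in which every integration by parts over
  the whole line is carried out.
\<close>

lemma primitive_of_integral_UNIV:
  assumes P: "primitive_of P f" and f: "integrable lebesgue f"
    and "(P \<longlongrightarrow> 0) at_top" "(P \<longlongrightarrow> 0) at_bot"
  shows "(LINT x|lebesgue. f x) = 0"
proof -
  have "(\<lambda>n. LINT x|lebesgue. indicat_real {- real n..real n} x * f x) \<longlonglongrightarrow> (LINT x|lebesgue. f x)"
  proof (rule integral_dominated_convergence[where w="\<lambda>x. \<bar>f x\<bar>"])
    show "f \<in> borel_measurable lebesgue" using f by auto
    show "(\<lambda>x. indicat_real {- real n..real n} x * f x) \<in> borel_measurable lebesgue" for n
      using f by (intro borel_measurable_times borel_measurable_indicator) auto
    show "integrable lebesgue (\<lambda>x. \<bar>f x\<bar>)" using f by simp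
    show "AE x in lebesgue. (\<lambda>n. indicat_real {- real n..real n} x * f x) \<longlonglongrightarrow> f x"
    proof (rule AE_I2)
      fix x :: real
      have "eventually (\<lambda>n. real n \<ge> \<bar>x\<bar>) sequentially"
        by (metis (no_types) eventually_sequentiallyI le_trans of_nat_mono real_nat_ceiling_ge order_trans)
      then have "eventually (\<lambda>n. indicat_real {- real n..real n} x * f x = f x) sequentially"
        by eventually_elim (auto simp: indicator_def abs_le_iff)
      then show "(\<lambda>n. indicat_real {- real n..real n} x * f x) \<longlonglongrightarrow> f x"
        by (rule tendsto_eventually)
    qed
    show "AE x in lebesgue. norm (indicat_real {- real n..real n} x * f x) \<le> \<bar>f x\<bar>" for n
      by (auto simp: indicator_def)
  qed
  moreover have "(LINT x|lebesgue. indicat_real {- real n..real n} x * f x) = P (real n) - P (- real n)" for n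
    using set_lebesgue_integral_eq_integral(2)[OF primitive_ofD(1)[OF P, of "- real n" "real n"]]
      primitive_ofD(3)[OF P, of "- real n" "real n"]
    by (simp add: set_lebesgue_integral_def)
  moreover have "(\<lambda>n. P (real n) - P (- real n)) \<longlonglongrightarrow> 0 - 0"
    by (intro tendsto_diff filterlim_compose[OF assms(3)] filterlim_compose[OF assms(4)] filterlim_real_sequentially
        filterlim_compose[OF filterlim_uminus_at_bot_at_top filterlim_real_sequentially])
  ultimately show ?thesis
    using LIMSEQ_unique by fastforce
qed



section \<open>Smooth cut-off functions\<close>

text \<open>
  The classical smooth function that is flat at the origin, together with the terms that occur in its
  derivatives: the derivative of the function with index k is a combination of those with indices
  k + 1 and k + 2.
\<close>

definition exp_bump :: "nat \<Rightarrow> real \<Rightarrow> real" where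
  "exp_bump k x = (if 0 < x then inverse x ^ k * exp (- inverse x) else 0)"

lemma exp_bump_tendsto_0: "(exp_bump k \<longlongrightarrow> 0) (at 0)"
proof -
  have "((\<lambda>x. inverse x ^ k / exp (inverse x)) \<longlongrightarrow> (0::real)) (at_right 0)"
    by (rule filterlim_compose[OF tendsto_power_div_exp_0 filterlim_inverse_at_top_right])
  then have r: "(exp_bump k \<longlongrightarrow> 0) (at_right 0)"
    by (rule Lim_transform_eventually)
       (auto simp: exp_bump_def eventually_at_filter exp_minus field_simps)
  have "(exp_bump k \<longlongrightarrow> 0) (at_left 0)"
    by (rule tendsto_eventually) (auto simp: exp_bump_def eventually_at_filter)
  with r show ?thesis
    by (simp add: filterlim_at_split)
qed

lemma exp_bump_derivative:
  "(exp_bump k has_real_derivative (exp_bump (k + 2) x - real k * exp_bump (k + 1) x)) (at x)"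
proof -
  consider "x > 0" | "x < 0" | "x = 0" by linarith
  then show ?thesis
  proof cases
    case 1
    have "((\<lambda>x. inverse x ^ k * exp (- inverse x)) has_real_derivative
        (exp_bump (k + 2) x - real k * exp_bump (k + 1) x)) (at x)"
      using 1 by (auto intro!: derivative_eq_intros simp: exp_bump_def)
        (cases k; simp add: field_simps power2_eq_square)
    then show ?thesis
      by (rule has_field_derivative_transform_within_open[of _ _ _ "{0<..}"]) (use 1 in \<open>auto simp: exp_bump_def\<close>)
  next
    case 2
    have "((\<lambda>x. 0) has_real_derivative (exp_bump (k + 2) x - real k * exp_bump (k + 1) x)) (at x)"
      using 2 by (simp add: exp_bump_def)
    then show ?thesis
      by (rule has_field_derivative_transform_within_open[of _ _ _ "{..<0}"]) (use 2 in \<open>auto simp: exp_bump_def\<close>)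
  next
    case 3
    \<comment> \<open>The difference quotient at 0 is the function of index k + 1.\<close>
    have "((\<lambda>h. exp_bump k h / h) \<longlongrightarrow> 0) (at 0)"
      by (rule Lim_transform_eventually[OF exp_bump_tendsto_0[of "k+1"]])
         (auto simp: exp_bump_def eventually_at_filter field_simps)
    then show ?thesis
      using 3 by (simp add: DERIV_def exp_bump_def)
  qed
qed

text \<open>
  An algebra that contains the cut-off functions below and is closed under differentiation; closure
  yields smoothness without computing any higher derivative.
\<close>

inductive_set smooth_class :: "(real \<Rightarrow> real) set" where
  const: "(\<lambda>x. c) \<in> smooth_class"
| bump: "(\<lambda>x. exp_bump k (s * x + t)) \<in> smooth_class"
| add: "f \<in> smooth_class \<Longrightarrow> g \<in> smooth_class \<Longrightarrow> (\<lambda>x. f x + g x) \<in> smooth_class"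
| mult: "f \<in> smooth_class \<Longrightarrow> g \<in> smooth_class \<Longrightarrow> (\<lambda>x. f x * g x) \<in> smooth_class"

lemma smooth_class_derivative:
  assumes "f \<in> smooth_class"
  shows "\<exists>f'\<in>smooth_class. \<forall>x. (f has_real_derivative f' x) (at x)"
  using assms
proof induction
  case (const c)
  show ?case
    by (rule bexI[OF _ smooth_class.const[of 0]]) auto
next
  case (bump k s t)
  let ?f' = "\<lambda>x. s * (exp_bump (k + 2) (s * x + t) + (- real k) * exp_bump (k + 1) (s * x + t))"
  have "?f' \<in> smooth_class"
    by (intro smooth_class.intros)
  moreover have "((\<lambda>x. exp_bump k (s * x + t)) has_real_derivative ?f' x) (at x)" for x
    by (rule DERIV_chain2[OF exp_bump_derivative, THEN DERIV_cong])
       (auto intro!: derivative_eq_intros)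
  ultimately show ?case
    by (intro bexI[of _ ?f']) auto
next
  case (add f g)
  then obtain f' g' where "f' \<in> smooth_class" "g' \<in> smooth_class"
    "\<forall>x. (f has_real_derivative f' x) (at x)" "\<forall>x. (g has_real_derivative g' x) (at x)" by blast
  then show ?case
    by (intro bexI[of _ "\<lambda>x. f' x + g' x"]) (auto intro: smooth_class.intros DERIV_add)
next
  case (mult f g)
  then obtain f' g' where "f' \<in> smooth_class" "g' \<in> smooth_class"
    "\<forall>x. (f has_real_derivative f' x) (at x)" "\<forall>x. (g has_real_derivative g' x) (at x)" by blast
  with mult.hyps show ?case
    by (intro bexI[of _ "\<lambda>x. f' x * g x + g' x * f x"]) (auto intro: smooth_class.intros DERIV_mult)
qed

lemma smooth_class_differentiable:
  assumes "f \<in> smooth_class"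
  shows "(deriv ^^ n) f differentiable (at x)"
proof -
  have closed: "deriv g \<in> smooth_class" if g: "g \<in> smooth_class" for g
  proof -
    obtain g' where g': "g' \<in> smooth_class" "\<And>x. (g has_real_derivative g' x) (at x)"
      using smooth_class_derivative[OF g] by blast
    then have "deriv g = g'"
      by (auto intro: DERIV_imp_deriv)
    then show ?thesis using g' by simp
  qed
  have "(deriv ^^ n) f \<in> smooth_class"
    by (induction n) (simp_all add: assms closed)
  from smooth_class_derivative[OF this] show ?thesis
    using real_differentiable_def by blast
qed

text \<open>
  Smooth functions with support in [c,d] that converge pointwise to the indicator of the open
  interval as n grows.
\<close>

definition plateau :: "real \<Rightarrow> real \<Rightarrow> nat \<Rightarrow> real \<Rightarrow> real" where
  "plateau c d n x = exp_bump 0 (real n * x + - (real n * c)) * exp_bump 0 (- real n * x + real n * d)"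

lemma plateau_eq_0: "x \<notin> {c<..<d} \<Longrightarrow> plateau c d n x = 0"
  by (auto simp: plateau_def exp_bump_def not_less zero_less_mult_iff simp flip: right_diff_distrib)

lemma plateau_bounds: "0 \<le> plateau c d n x" "plateau c d n x \<le> 1"
proof -
  have "0 \<le> exp_bump 0 t \<and> exp_bump 0 t \<le> 1" for t
    by (auto simp: exp_bump_def)
  then show "0 \<le> plateau c d n x" "plateau c d n x \<le> 1"
    unfolding plateau_def by (simp_all add: mult_le_one)
qed

lemma plateau_pos: "c < x \<Longrightarrow> x < d \<Longrightarrow> 0 < n \<Longrightarrow> 0 < plateau c d n x"
  by (auto simp: plateau_def exp_bump_def)

lemma plateau_tendsto:
  assumes "c < x" "x < d"
  shows "(\<lambda>n. plateau c d n x) \<longlonglongrightarrow> 1"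
proof -
  have *: "(\<lambda>n. exp_bump 0 (real n * s)) \<longlonglongrightarrow> 1" if "s > 0" for s
  proof -
    have "(\<lambda>n. exp (- inverse (real n) * inverse s)) \<longlonglongrightarrow> exp (- 0 * inverse s)"
      by (intro tendsto_intros lim_inverse_n)
    then have "(\<lambda>n. exp (- inverse (real n) * inverse s)) \<longlonglongrightarrow> 1"
      by simp
    then show ?thesis
      by (rule Lim_transform_eventually)
         (use that in \<open>auto simp: exp_bump_def intro!: eventually_sequentiallyI[of 1]\<close>)
  qed
  have "(\<lambda>n. exp_bump 0 (real n * (x - c)) * exp_bump 0 (real n * (d - x))) \<longlonglongrightarrow> 1 * 1"
    by (intro tendsto_mult *) (use assms in auto)
  then show ?thesis
    by (simp add: plateau_def algebra_simps)
qed

lemma plateau_test_function: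
  assumes "{c..d} \<subseteq> \<Omega>"
  shows "plateau c d n \<in> test_functions \<Omega>"
proof -
  have "plateau c d n \<in> smooth_class"
    unfolding plateau_def[abs_def] by (intro smooth_class.intros)
  moreover have "closure {x. plateau c d n x \<noteq> 0} \<subseteq> {c..d}"
    proof (rule closure_minimal)
    show "{x. plateau c d n x \<noteq> 0} \<subseteq> {c..d}"
    proof
      fix x assume "x \<in> {x. plateau c d n x \<noteq> 0}"
      then have "x \<in> {c<..<d}" using plateau_eq_0 by blast
      then show "x \<in> {c..d}" by simp
    qed
  qed simp
  ultimately show ?thesis
    using assms compact_Icc closed_closure compact_Int_closed[of "{c..d}" "closure {x. plateau c d n x \<noteq> 0}"]
    by (auto simp: test_functions_def smooth_class_differentiable inf_absorb2)
qed

section \<open>Test functions and the fundamental lemma of the calculus of variations\<close>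

lemma test_function_has_derivative:
  assumes "\<phi> \<in> test_functions \<Omega>"
  shows "(\<phi> has_real_derivative deriv \<phi> x) (at x)"
proof -
  have "(deriv ^^ 0) \<phi> differentiable (at x)"
    using assms unfolding test_functions_def by blast
  then show ?thesis
    by (simp add: DERIV_deriv_iff_real_differentiable)
qed

lemma test_function_continuous:
  assumes "\<phi> \<in> test_functions \<Omega>"
  shows "continuous_on S \<phi>"
  by (meson DERIV_isCont assms continuous_at_imp_continuous_on test_function_has_derivative)

lemma test_function_support:
  assumes "\<phi> \<in> test_functions \<Omega>"
  obtains C where "compact C" "C \<subseteq> \<Omega>" "\<And>x. x \<notin> C \<Longrightarrow> \<phi> x = 0"
  using assms closure_subset[of "{x. \<phi> x \<noteq> 0}"] unfolding test_functions_def by blast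

lemma test_functionI:
  assumes "\<And>n x. (deriv ^^ n) \<phi> differentiable (at x)"
    and "compact C" "C \<subseteq> \<Omega>" "\<And>x. x \<notin> C \<Longrightarrow> \<phi> x = 0"
  shows "\<phi> \<in> test_functions \<Omega>"
proof -
  have "closure {x. \<phi> x \<noteq> 0} \<subseteq> C"
    by (rule closure_minimal) (use assms compact_imp_closed in auto)
  then show ?thesis
    using assms compact_Int_closed[of C "closure {x. \<phi> x \<noteq> 0}"]
    by (auto simp: test_functions_def inf_absorb2)
qed

lemma deriv_in_test_functions:
  assumes "\<phi> \<in> test_functions \<Omega>"
  shows "deriv \<phi> \<in> test_functions \<Omega>"
proof -
  obtain C where C: "compact C" "C \<subseteq> \<Omega>" "\<And>x. x \<notin> C \<Longrightarrow> \<phi> x = 0"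
    using test_function_support[OF assms] by blast
  show ?thesis
  proof (rule test_functionI[OF _ C(1,2)])
    fix n x
    have "(deriv ^^ Suc n) \<phi> differentiable (at x)"
      using assms unfolding test_functions_def by blast
    then show "(deriv ^^ n) (deriv \<phi>) differentiable (at x)"
      by (simp add: funpow_swap1)
  next
    fix x assume "x \<notin> C"
    moreover have "open (- C)" using C(1) compact_imp_closed by auto
    ultimately have "(\<phi> has_real_derivative 0) (at x)"
      by (intro has_field_derivative_transform_within_open[of "\<lambda>_. 0" 0 x "-C" \<phi>]) (use C(3) in auto)
    then show "deriv \<phi> x = 0" by (rule DERIV_imp_deriv)
  qed
qed

lemma test_functions_mono: "\<Omega> \<subseteq> \<Omega>' \<Longrightarrow> test_functions \<Omega> \<subseteq> test_functions \<Omega>'"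
  unfolding test_functions_def by blast

lemma integrable_mult_test_function:
  assumes "locally_integrable \<Omega> g" "\<phi> \<in> test_functions \<Omega>" "\<Omega> \<in> sets lebesgue"
  shows "integrable (lebesgue_on \<Omega>) (\<lambda>x. g x * \<phi> x)"
proof -
  obtain C where C: "compact C" "C \<subseteq> \<Omega>" "\<And>x. x \<notin> C \<Longrightarrow> \<phi> x = 0"
    using test_function_support[OF assms(2)] by blast
  have "(\<lambda>x. \<phi> x * g x) absolutely_integrable_on C"
  proof (rule absolutely_integrable_bounded_measurable_product_real)
    show CC: "C \<in> sets lebesgue" using C(1) by (simp add: compact_imp_closed borel_closed)
    show "\<phi> \<in> borel_measurable (lebesgue_on C)"
      by (rule continuous_imp_measurable_on_sets_lebesgue[OF test_function_continuous[OF assms(2)] CC])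
    show "bounded (\<phi> ` C)"
      by (intro compact_imp_bounded compact_continuous_image C test_function_continuous[OF assms(2)])
    show "g absolutely_integrable_on C"
      using assms(1) C by (auto simp: locally_integrable_def)
  qed
  then have "integrable lebesgue (\<lambda>x. indicat_real C x *\<^sub>R (\<phi> x * g x))"
    by (simp add: set_integrable_def)
  moreover have "(\<lambda>x. indicat_real C x *\<^sub>R (\<phi> x * g x)) = (\<lambda>x. indicat_real \<Omega> x *\<^sub>R (g x * \<phi> x))"
    using C by (auto simp: fun_eq_iff indicator_def)
  ultimately show ?thesis
    using assms(3) by (simp add: integrable_restrict_space)
qed

lemma lebesgue_on_integral_supported:
  fixes f :: "real \<Rightarrow> real"
  assumes "\<Omega> \<in> sets lebesgue" "S \<subseteq> \<Omega>" "\<And>x. x \<in> \<Omega> - S \<Longrightarrow> f x = 0"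
    and "f absolutely_integrable_on S"
  shows "(LINT x|lebesgue_on \<Omega>. f x) = integral S f"
proof -
  have "(LINT x|lebesgue_on \<Omega>. f x) = (LINT x|lebesgue. indicat_real \<Omega> x *\<^sub>R f x)"
    using assms(1) by (simp add: integral_restrict_space)
  also have "(\<lambda>x. indicat_real \<Omega> x *\<^sub>R f x) = (\<lambda>x. indicat_real S x *\<^sub>R f x)"
    using assms(2,3) by (auto simp: fun_eq_iff indicator_def)
  also have "(LINT x|lebesgue. indicat_real S x *\<^sub>R f x) = integral S f"
    using set_lebesgue_integral_eq_integral(2)[OF assms(4)] by (simp add: set_lebesgue_integral_def)
  finally show ?thesis .
qed

text \<open>
  The plateaus tend to indicators, so by dominated convergence all integrals of g over subintervals
  vanish; almost every point is a Lebesgue point, where g is the limit of its means.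
\<close>

lemma AE_zero_on_interval_if_orthogonal_to_plateaus:
  assumes g: "g absolutely_integrable_on {c..d}"
    and orth: "\<And>c' d' n. \<lbrakk>c \<le> c'; d' \<le> d\<rbrakk> \<Longrightarrow> integral {c'..d'} (\<lambda>x. g x * plateau c' d' n x) = 0"
  shows "AE x in lebesgue. x \<in> {c..d} \<longrightarrow> g x = 0"
proof -
  have gi: "g absolutely_integrable_on {c'..d'}" if "c \<le> c'" "d' \<le> d" for c' d'
    by (rule set_integrable_subset[OF g]) (use that in auto)
  have zero: "integral {c'..d'} g = 0" if "c \<le> c'" "d' \<le> d" for c' d'
  proof -
    define h where "h = (\<lambda>x. if x \<in> {c'<..<d'} then g x else 0)"
    have "(\<lambda>n. integral {c'..d'} (\<lambda>x. g x * plateau c' d' n x)) \<longlonglongrightarrow> integral {c'..d'} h"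
    proof (rule dominated_convergence(2)[where h="\<lambda>x. \<bar>g x\<bar>"])
      fix n
      have "(\<lambda>x. plateau c' d' n x * g x) absolutely_integrable_on {c'..d'}"
        by (intro absolutely_integrable_continuous_mult gi that test_function_continuous[OF plateau_test_function[OF order_refl]])
      then show "(\<lambda>x. g x * plateau c' d' n x) integrable_on {c'..d'}"
        by (simp add: mult.commute set_lebesgue_integral_eq_integral(1))
      show "norm (g x * plateau c' d' n x) \<le> \<bar>g x\<bar>" for x
        using plateau_bounds[of c' d' n x] by (simp add: abs_mult mult_left_le)
    next
      show "(\<lambda>x. \<bar>g x\<bar>) integrable_on {c'..d'}"
        using gi[OF that] by (simp add: absolutely_integrable_on_def)
      fix x
      show "(\<lambda>n. g x * plateau c' d' n x) \<longlonglongrightarrow> h x"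
      proof (cases "x \<in> {c'<..<d'}")
        case True
        have "(\<lambda>n. g x * plateau c' d' n x) \<longlonglongrightarrow> g x * 1"
          by (intro tendsto_mult tendsto_const plateau_tendsto) (use True in auto)
        then show ?thesis using True by (simp add: h_def)
      next
        case False
        then have "h x = 0" unfolding h_def by auto
        with plateau_eq_0[OF False] show ?thesis by simp
      qed
    qed
    then have "integral {c'..d'} h = 0"
      using orth[OF that] LIMSEQ_unique[of "\<lambda>n. 0" 0] by simp
    also have "integral {c'..d'} h = integral {c'..d'} g"
      by (rule integral_spike[of "{c',d'}"]) (auto simp: h_def)
    finally show ?thesis .
  qed
  \<comment> \<open>Extension by zero, because the differentiation theorem asks for integrability on all intervals.\<close>
  define g' where "g' = (\<lambda>x. if x \<in> {c..d} then g x else 0)"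
  have g'int: "g' integrable_on cbox x y \<and> integral (cbox x y) g' = 0" for x y
  proof -
    have "g integrable_on {max c x..min d y}"
      by (intro set_lebesgue_integral_eq_integral(1) gi) auto
    then have "(g has_integral 0) {max c x..min d y}"
      using zero[of "max c x" "min d y"] by (metis has_integral_integral max.cobounded1 min.cobounded1)
    moreover have "{max c x..min d y} = {c..d} \<inter> cbox x y" by auto
    ultimately have "(g' has_integral 0) (cbox x y)"
      unfolding g'_def by (simp only: has_integral_restrict_Int)
    then show ?thesis by auto
  qed
  obtain N where N: "negligible N"
     "\<And>x e. \<lbrakk>x \<notin> N; 0 < e\<rbrakk> \<Longrightarrow> \<exists>k>0. \<forall>h. 0 < h \<and> h < k \<longrightarrow>
        norm(integral (cbox x (x + h *\<^sub>R One)) g' /\<^sub>R h ^ DIM(real) - g' x) < e"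
    using integrable_ccontinuous_explicit[of g'] g'int by blast
  have "g' x = 0" if xN: "x \<notin> N" for x
  proof (rule ccontr)
    assume "g' x \<noteq> 0"
    then obtain k where "k > 0" and k: "\<forall>h. 0 < h \<and> h < k \<longrightarrow>
        norm(integral (cbox x (x + h *\<^sub>R One)) g' /\<^sub>R h ^ DIM(real) - g' x) < \<bar>g' x\<bar>"
      using N(2)[OF xN, of "\<bar>g' x\<bar>"] by auto
    have *: "integral (cbox x (x + (k/2) *\<^sub>R One)) g' = 0"
      using g'int by blast
    have "norm(integral (cbox x (x + (k/2) *\<^sub>R One)) g' /\<^sub>R (k/2) ^ DIM(real) - g' x) < \<bar>g' x\<bar>"
      using k[rule_format, of "k/2"] \<open>k > 0\<close> by auto
    then show False unfolding * by simp
  qed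
  then have "AE x in lebesgue. g' x = 0"
    using N(1) by (auto simp: eventually_ae_filter_negligible)
  then show ?thesis
    by eventually_elim (auto simp: g'_def)
qed

text \<open>
  An open set is a countable union of compact intervals, so it suffices to treat each of them.
\<close>

theorem fundamental_lemma_of_calculus_of_variations:
  assumes "open \<Omega>" "locally_integrable \<Omega> g"
    and orth: "\<And>\<phi>. \<phi> \<in> test_functions \<Omega> \<Longrightarrow> (LINT x|lebesgue_on \<Omega>. g x * \<phi> x) = 0"
  shows "AE x in lebesgue_on \<Omega>. g x = 0"
proof -
  have \<Omega>: "\<Omega> \<in> sets lebesgue" using assms(1) by simp
  have box: "AE x in lebesgue. x \<in> {c..d} \<longrightarrow> g x = 0" if "{c..d} \<subseteq> \<Omega>" for c d
  proof (rule AE_zero_on_interval_if_orthogonal_to_plateaus)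
    show g: "g absolutely_integrable_on {c..d}"
      using assms(2) that by (auto simp: locally_integrable_def)
    fix c' d' n assume le: "c \<le> c'" "d' \<le> d"
    then have sub: "{c'..d'} \<subseteq> \<Omega>" using that by force
    have g': "g absolutely_integrable_on {c'..d'}"
      by (rule set_integrable_subset[OF g]) (use le in auto)
    have "(\<lambda>x. plateau c' d' n x * g x) absolutely_integrable_on {c'..d'}"
      by (intro absolutely_integrable_continuous_mult g' test_function_continuous[OF plateau_test_function[OF order_refl]])
    then have "(LINT x|lebesgue_on \<Omega>. g x * plateau c' d' n x) = integral {c'..d'} (\<lambda>x. g x * plateau c' d' n x)"
      by (intro lebesgue_on_integral_supported \<Omega> sub) (auto simp: plateau_eq_0 mult.commute)
    then show "integral {c'..d'} (\<lambda>x. g x * plateau c' d' n x) = 0"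
      using orth[OF plateau_test_function[OF sub]] by simp
  qed
  obtain \<D> where \<D>: "countable \<D>" "\<And>X. X \<in> \<D> \<Longrightarrow> \<exists>a b. X = cbox a b \<and> X \<subseteq> \<Omega>" "\<Union>\<D> = \<Omega>"
    using open_countable_Union_open_cbox[OF assms(1)] by (metis Pow_iff subset_eq)
  have "AE x in lebesgue. \<forall>X\<in>\<D>. x \<in> X \<longrightarrow> g x = 0"
    using \<D>(2) box by (subst AE_ball_countable[OF \<D>(1)]) (metis cbox_interval)
  then show ?thesis
    using \<Omega> \<D>(3) by (subst AE_restrict_space_iff) (auto elim!: eventually_mono)
qed



section \<open>Weak derivatives on the line\<close>

lemma compact_abs_le:
  fixes C :: "real set"
  assumes "compact C"
  obtains M where "\<And>x. x \<in> C \<Longrightarrow> \<bar>x\<bar> \<le> M"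
  using compact_imp_bounded[OF assms] unfolding bounded_real by blast


lemma test_function_zero_outside:
  assumes "\<phi> \<in> test_functions \<Omega>" "x \<notin> \<Omega>"
  shows "\<phi> x = 0"
proof -
  obtain C where C: "compact C" "C \<subseteq> \<Omega>" "\<And>x. x \<notin> C \<Longrightarrow> \<phi> x = 0"
    using test_function_support[OF assms(1)] by blast
  then show ?thesis using assms(2) by blast
qed

lemma locally_integrable_if_on_intervals:
  assumes "\<And>x y. f absolutely_integrable_on {x..y}"
  shows "locally_integrable \<Omega> f"
  unfolding locally_integrable_def
proof (intro allI impI)
  fix C :: "real set" assume C: "compact C \<and> C \<subseteq> \<Omega>"
  then obtain M where "\<And>x. x \<in> C \<Longrightarrow> \<bar>x\<bar> \<le> M"
    using compact_abs_le by blast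
  then have sub: "C \<subseteq> {-M..M}" by (force simp: abs_le_iff)
  show "f absolutely_integrable_on C"
    by (rule set_integrable_subset[OF assms _ sub]) (use C in \<open>simp add: compact_imp_closed borel_closed\<close>)
qed

lemma locally_integrable_continuous:
  assumes "continuous_on UNIV f"
  shows "locally_integrable \<Omega> f"
  using assms continuous_on_subset
  by (intro locally_integrable_if_on_intervals absolutely_integrable_continuous_real) blast

lemma locally_integrable_UNIV_iff:
  "locally_integrable UNIV f \<longleftrightarrow> (\<forall>x y. f absolutely_integrable_on {x..y})"
proof
  assume "locally_integrable UNIV f"
  then show "\<forall>x y. f absolutely_integrable_on {x..y}"
    using compact_Icc unfolding locally_integrable_def by blast
next
  assume "\<forall>x y. f absolutely_integrable_on {x..y}"
  then show "locally_integrable UNIV f"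
    by (intro locally_integrable_if_on_intervals) blast
qed

lemma lebesgue_on_integral_test_function:
  assumes "\<Omega> \<in> sets lebesgue" "\<phi> \<in> test_functions \<Omega>"
  shows "(LINT x|lebesgue_on \<Omega>. f x * \<phi> x) = (LINT x|lebesgue. f x * \<phi> x)"
proof -
  obtain C where C: "compact C" "C \<subseteq> \<Omega>" "\<And>x. x \<notin> C \<Longrightarrow> \<phi> x = 0"
    using test_function_support[OF assms(2)] by blast
  have "(LINT x|lebesgue_on \<Omega>. f x * \<phi> x) = (LINT x|lebesgue. indicat_real \<Omega> x *\<^sub>R (f x * \<phi> x))"
    using assms(1) by (simp add: integral_restrict_space)
  also have "(\<lambda>x. indicat_real \<Omega> x *\<^sub>R (f x * \<phi> x)) = (\<lambda>x. f x * \<phi> x)"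
    using C by (auto simp: fun_eq_iff indicator_def)
  finally show ?thesis .
qed

lemma test_function_eventually_0:
  assumes "\<phi> \<in> test_functions \<Omega>"
  shows "eventually (\<lambda>x. \<phi> x = 0) at_top" "eventually (\<lambda>x. \<phi> x = 0) at_bot"
proof -
  obtain C where C: "compact C" "C \<subseteq> \<Omega>" "\<And>x. x \<notin> C \<Longrightarrow> \<phi> x = 0"
    using test_function_support[OF assms] by blast
  obtain M where M: "\<And>x. x \<in> C \<Longrightarrow> \<bar>x\<bar> \<le> M"
    using compact_abs_le[OF C(1)] by blast
  show "eventually (\<lambda>x. \<phi> x = 0) at_top"
    using eventually_gt_at_top[of M] by eventually_elim (use M C(3) in force)
  show "eventually (\<lambda>x. \<phi> x = 0) at_bot"
    using eventually_gt_at_bot[of "-M"] by eventually_elim (use M C(3) in force)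
qed

lemma test_function_derivative_primitive:
  assumes "\<phi> \<in> test_functions \<Omega>"
  shows "primitive_of \<phi> (deriv \<phi>)"
  by (rule primitive_of_C1[OF test_function_has_derivative[OF assms]])
     (rule test_function_continuous[OF deriv_in_test_functions[OF assms]])

lemma has_weak_deriv_unique:
  assumes "open \<Omega>" "has_weak_deriv k \<Omega> u g" "has_weak_deriv k \<Omega> u g'"
  shows "AE x in lebesgue_on \<Omega>. g x = g' x"
proof -
  have li: "locally_integrable \<Omega> g" "locally_integrable \<Omega> g'"
    using assms by (auto simp: has_weak_deriv_def)
  then have li2: "locally_integrable \<Omega> (\<lambda>x. g x - g' x)"
    by (auto simp: locally_integrable_def)
  have \<Omega>: "\<Omega> \<in> sets lebesgue" using assms(1) by simp
  have "AE x in lebesgue_on \<Omega>. g x - g' x = 0"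
  proof (rule fundamental_lemma_of_calculus_of_variations[OF assms(1) li2])
    fix \<phi> assume \<phi>: "\<phi> \<in> test_functions \<Omega>"
    have "(-1) ^ k * (LINT x|lebesgue_on \<Omega>. g x * \<phi> x) = (-1) ^ k * (LINT x|lebesgue_on \<Omega>. g' x * \<phi> x)"
      using assms(2)[unfolded has_weak_deriv_def, THEN conjunct2, THEN conjunct2, rule_format, OF \<phi>]
        assms(3)[unfolded has_weak_deriv_def, THEN conjunct2, THEN conjunct2, rule_format, OF \<phi>] by (rule trans[OF sym])
    then have "(LINT x|lebesgue_on \<Omega>. g x * \<phi> x) = (LINT x|lebesgue_on \<Omega>. g' x * \<phi> x)"
      by simp
    then show "(LINT x|lebesgue_on \<Omega>. (g x - g' x) * \<phi> x) = 0"
      using li \<phi> \<Omega> by (simp add: left_diff_distrib integrable_mult_test_function)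
  qed
  then show ?thesis by simp
qed

lemma has_weak_deriv_weak_deriv: "has_weak_deriv k \<Omega> u g \<Longrightarrow> has_weak_deriv k \<Omega> u (weak_deriv k \<Omega> u)"
  unfolding weak_deriv_def by (rule someI[of "has_weak_deriv k \<Omega> u"])

lemma weak_deriv_AE_eq:
  assumes "open \<Omega>" "has_weak_deriv k \<Omega> u g"
  shows "AE x in lebesgue_on \<Omega>. weak_deriv k \<Omega> u x = g x"
  using has_weak_deriv_unique[OF assms(1) has_weak_deriv_weak_deriv[OF assms(2)] assms(2)] .

text \<open>
  A jump at \<open>a\<close> is invisible on an open set that avoids \<open>a\<close>, since test functions vanish there.  One
  statement thus covers continuous functions with a kink on the line, and functions with a jump on the
  punctured line.
\<close>

lemma has_weak_deriv_piecewise_primitive: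
  fixes Pl Pr l r :: "real \<Rightarrow> real"
  assumes l: "primitive_of Pl l" and r: "primitive_of Pr r"
    and \<Omega>: "open \<Omega>" and agree: "a \<in> \<Omega> \<Longrightarrow> Pl a = Pr a"
  shows "has_weak_deriv 1 \<Omega> (\<lambda>x. if a \<le> x then Pr x else Pl x) (\<lambda>x. if a \<le> x then r x else l x)"
proof -
  let ?P = "\<lambda>x. if a \<le> x then Pr x else Pl x" and ?f = "\<lambda>x. if a \<le> x then r x else l x"
  have ai: "(\<lambda>x. if a \<le> x then f x else g x) absolutely_integrable_on {x..y}"
    if "\<And>x y. f absolutely_integrable_on {x..y}" "\<And>x y. g absolutely_integrable_on {x..y}" for f g :: "real \<Rightarrow> real" and x y
  proof -
    have ind: "(\<lambda>t. indicat_real S t * h t) absolutely_integrable_on {x..y}"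
      if "h absolutely_integrable_on {x..y}" "S \<in> sets lebesgue" for h :: "real \<Rightarrow> real" and S
    proof (rule absolutely_integrable_bounded_measurable_product_real[OF _ _ _ that(1)])
      show "indicat_real S \<in> borel_measurable (lebesgue_on {x..y})"
        by (rule measurable_restrict_space1) (use that(2) in simp)
      show "bounded (indicat_real S ` {x..y})"
        by (auto simp: bounded_real indicator_def intro!: exI[of _ 1])
    qed simp
    have "(\<lambda>t. indicat_real {a..} t * f t + indicat_real {..<a} t * g t) absolutely_integrable_on {x..y}"
      by (intro set_integral_add(1) ind that) simp_all
    moreover have "(\<lambda>t. (indicat_real {a..} t) * f t + indicat_real {..<a} t * g t) = (\<lambda>x. if a \<le> x then f x else g x)"
      by (auto simp: fun_eq_iff indicator_def)
    ultimately show ?thesis by simp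
  qed
  have cl: "Pl absolutely_integrable_on {x..y}" and cr: "Pr absolutely_integrable_on {x..y}" for x y
    using l r continuous_on_subset primitive_of_continuous
    by (blast intro: absolutely_integrable_continuous_real)+
  have liP: "locally_integrable S ?P" and lif: "locally_integrable S ?f" for S
    by (rule locally_integrable_if_on_intervals, rule ai; rule cl cr primitive_ofD[OF l] primitive_ofD[OF r])+
  have \<Omega>s: "\<Omega> \<in> sets lebesgue" using \<Omega> by simp
  have "(LINT x|lebesgue_on \<Omega>. ?P x * deriv \<phi> x) = - (LINT x|lebesgue_on \<Omega>. ?f x * \<phi> x)"
    if \<phi>: "\<phi> \<in> test_functions \<Omega>" for \<phi>
  proof -
    have \<phi>U: "\<phi> \<in> test_functions UNIV" using \<phi> test_functions_mono by blast
    have \<phi>0: "Pl a * \<phi> a = Pr a * \<phi> a"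
    proof (cases "a \<in> \<Omega>")
      case False
      then have "\<phi> a = 0" by (rule test_function_zero_outside[OF \<phi>])
      then show ?thesis by simp
    qed (simp add: agree)
    have prim: "primitive_of (\<lambda>x. if a \<le> x then Pr x * \<phi> x else Pl x * \<phi> x)
        (\<lambda>x. if a \<le> x then Pr x * deriv \<phi> x + \<phi> x * r x else Pl x * deriv \<phi> x + \<phi> x * l x)"
      by (intro primitive_of_glue primitive_of_mult l r test_function_derivative_primitive[OF \<phi>] \<phi>0)
    have eq: "(\<lambda>x. if a \<le> x then Pr x * deriv \<phi> x + \<phi> x * r x else Pl x * deriv \<phi> x + \<phi> x * l x)
       = (\<lambda>x. ?P x * deriv \<phi> x + ?f x * \<phi> x)" by auto
    have i: "integrable lebesgue (\<lambda>x. ?P x * deriv \<phi> x)" "integrable lebesgue (\<lambda>x. ?f x * \<phi> x)"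
      using integrable_mult_test_function[OF liP deriv_in_test_functions[OF \<phi>U]]
        integrable_mult_test_function[OF lif \<phi>U] by (auto simp: lebesgue_on_UNIV_eq)
    have "(LINT x|lebesgue. ?P x * deriv \<phi> x + ?f x * \<phi> x) = 0"
    proof (rule primitive_of_integral_UNIV[OF prim[unfolded eq]])
      show "integrable lebesgue (\<lambda>x. ?P x * deriv \<phi> x + ?f x * \<phi> x)"
        using i by simp
      have t: "eventually (\<lambda>x. (if a \<le> x then Pr x * \<phi> x else Pl x * \<phi> x) = 0) at_top"
        using test_function_eventually_0(1)[OF \<phi>] by eventually_elim auto
      have b: "eventually (\<lambda>x. (if a \<le> x then Pr x * \<phi> x else Pl x * \<phi> x) = 0) at_bot"
        using test_function_eventually_0(2)[OF \<phi>] by eventually_elim auto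
      show "((\<lambda>x. if a \<le> x then Pr x * \<phi> x else Pl x * \<phi> x) \<longlongrightarrow> 0) at_top"
           "((\<lambda>x. if a \<le> x then Pr x * \<phi> x else Pl x * \<phi> x) \<longlongrightarrow> 0) at_bot"
        by (rule tendsto_eventually[OF t], rule tendsto_eventually[OF b])
    qed
    then have "(LINT x|lebesgue. ?P x * deriv \<phi> x) = - (LINT x|lebesgue. ?f x * \<phi> x)"
      using i by simp
    then show ?thesis
      by (simp only: lebesgue_on_integral_test_function[OF \<Omega>s \<phi>]
         lebesgue_on_integral_test_function[OF \<Omega>s deriv_in_test_functions[OF \<phi>]])
  qed
  then show ?thesis
    using liP lif by (simp add: has_weak_deriv_def)
qed

lemma has_weak_deriv_primitive:
  assumes "primitive_of P f"
  shows "has_weak_deriv 1 UNIV P f"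
  using has_weak_deriv_piecewise_primitive[OF assms assms, of UNIV 0] by simp

lemma has_weak_deriv_by_parts:
  assumes "has_weak_deriv 1 \<Omega> u g" "\<phi> \<in> test_functions \<Omega>"
  shows "(LINT x|lebesgue_on \<Omega>. u x * deriv \<phi> x) = - (LINT x|lebesgue_on \<Omega>. g x * \<phi> x)"
  using assms(1)[unfolded has_weak_deriv_def, THEN conjunct2, THEN conjunct2, rule_format, OF assms(2)] by simp

text \<open>
  Integration by parts twice, against the test functions \<phi>' and \<phi>.
\<close>

lemma has_weak_deriv_trans:
  assumes "has_weak_deriv 1 \<Omega> u g" "has_weak_deriv 1 \<Omega> g h"
  shows "has_weak_deriv 2 \<Omega> u h"
proof -
  have "(LINT x|lebesgue_on \<Omega>. u x * deriv (deriv \<phi>) x) = (LINT x|lebesgue_on \<Omega>. h x * \<phi> x)"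
    if \<phi>: "\<phi> \<in> test_functions \<Omega>" for \<phi>
    using has_weak_deriv_by_parts[OF assms(1) deriv_in_test_functions[OF \<phi>]] has_weak_deriv_by_parts[OF assms(2) \<phi>] by simp
  then show ?thesis
    using assms unfolding has_weak_deriv_def by (simp add: numeral_2_eq_2)
qed

lemma primitive_of_exists:
  assumes ai: "\<And>x y. g absolutely_integrable_on {x..y}"
  shows "\<exists>P. primitive_of P g"
proof -
  have i: "g integrable_on {x..y}" for x y
    by (rule set_lebesgue_integral_eq_integral(1)[OF ai])
  define P where "P = (\<lambda>x. if 0 \<le> x then integral {0..x} g else - integral {x..0} g)"
  have "integral {x..y} g = P y - P x" if "x \<le> y" for x y
  proof -
    consider "0 \<le> x" | "x < 0" "0 \<le> y" | "y < 0" by linarith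
    then show ?thesis
    proof cases
      case 1 then show ?thesis
        using Henstock_Kurzweil_Integration.integral_combine[of 0 x y, OF _ that i] that by (simp add: P_def)
    next
      case 2 then show ?thesis
        using Henstock_Kurzweil_Integration.integral_combine[of x 0 y, OF _ _ i] by (simp add: P_def)
    next
      case 3 then show ?thesis
        using Henstock_Kurzweil_Integration.integral_combine[of x y 0, OF that _ i] that by (simp add: P_def)
    qed
  qed
  then have "primitive_of P g"
    using ai by (simp add: primitive_of_def)
  then show ?thesis by blast
qed

lemma primitive_of_has_derivative:
  assumes P: "primitive_of P f" and f: "continuous_on UNIV f"
  shows "(P has_real_derivative f x) (at x)"
proof -
  have "((\<lambda>y. integral {x-1..y} f) has_real_derivative f x) (at x within {x-1..x+1})"
    using f continuous_on_subset by (intro integral_has_real_derivative) auto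
  then have "((\<lambda>y. P (x-1) + integral {x-1..y} f) has_real_derivative f x) (at x within {x-1..x+1})"
    by (auto intro!: derivative_eq_intros)
  then have "(P has_real_derivative f x) (at x within {x-1..x+1})"
    by (rule has_field_derivative_transform_within[where d=1]) (auto simp: primitive_ofD(3)[OF P])
  then show ?thesis
    by (simp add: at_within_Icc_at)
qed

text \<open>
  A nonempty open set is not negligible.
\<close>

lemma AE_eq_continuous_imp_eq:
  fixes f g :: "real \<Rightarrow> real"
  assumes "continuous_on UNIV f" "continuous_on UNIV g" "AE x in lebesgue. f x = g x"
  shows "f = g"
proof -
  have "open {x. f x \<noteq> g x}"
    by (rule open_Collect_neq[OF assms(1,2)])
  moreover have "negligible {x. f x \<noteq> g x}"
    using assms(3) by (auto simp: eventually_ae_filter_negligible intro: negligible_subset)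
  ultimately have "{x. f x \<noteq> g x} = {}"
    using open_not_negligible by blast
  then show ?thesis by auto
qed

section \<open>The du Bois-Reymond lemma\<close>

text \<open>
  The primitive that vanishes far to the left is constant to the right of the support, and the mean
  value condition makes that constant zero.
\<close>

lemma mean_zero_test_function_is_derivative:
  assumes \<psi>: "\<psi> \<in> test_functions UNIV" and mean: "(LINT x|lebesgue. \<psi> x) = 0"
  shows "\<exists>\<phi>\<in>test_functions UNIV. deriv \<phi> = \<psi>"
proof -
  obtain C where C: "compact C" "C \<subseteq> UNIV" "\<And>x. x \<notin> C \<Longrightarrow> \<psi> x = 0"
    using test_function_support[OF \<psi>] by blast
  obtain M where M: "\<And>x. x \<in> C \<Longrightarrow> \<bar>x\<bar> \<le> M"
    using compact_abs_le[OF C(1)] by blast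
  have \<psi>0: "\<psi> x = 0" if "x \<notin> {-M..M}" for x
  proof -
    have "x \<notin> C"
    proof
      assume "x \<in> C"
      from M[OF this] that show False by (simp add: abs_le_iff)
    qed
    then show ?thesis by (rule C(3))
  qed
  have ai: "\<psi> absolutely_integrable_on {x..y}" for x y
    by (rule absolutely_integrable_continuous_real) (rule test_function_continuous[OF \<psi>])
  have i: "\<psi> integrable_on {x..y}" for x y
    by (rule set_lebesgue_integral_eq_integral(1)[OF ai])
  obtain P where P: "primitive_of P \<psi>"
    using primitive_of_exists[OF ai] by blast
  have total: "integral {-M..M} \<psi> = 0"
    using lebesgue_on_integral_supported[OF _ subset_UNIV \<psi>0 ai, of "-M" M] mean
    by (simp add: lebesgue_on_UNIV_eq)
  define \<phi> where "\<phi> = (\<lambda>x. P x - P (-M))"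
  have \<phi>: "\<phi> y - \<phi> x = integral {x..y} \<psi>" if "x \<le> y" for x y
    using primitive_ofD(3)[OF P that] by (simp add: \<phi>_def)
  have \<phi>0: "\<phi> x = 0" if x: "x \<notin> {-M..M}" for x
  proof (cases "x < -M")
    case True
    have "integral {x..-M} \<psi> = integral {x..-M} (\<lambda>_. 0)"
      by (rule integral_spike[of "{-M}"]) (use \<psi>0 in auto)
    then show ?thesis using \<phi>[of x "-M"] True by (simp add: \<phi>_def)
  next
    case False
    with x have x: "M < x" "-M \<le> x" by auto
    have "\<phi> M = 0 \<or> M < -M"
      using \<phi>[of "-M" M] total by (auto simp: \<phi>_def)
    then show ?thesis
    proof
      assume "\<phi> M = 0"
      moreover have "integral {M..x} \<psi> = integral {M..x} (\<lambda>_. 0)"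
        by (rule integral_spike[of "{M}"]) (use \<psi>0 in auto)
      ultimately show ?thesis using \<phi>[of M x] x by simp
    next
      assume "M < -M"
      then have "integral {-M..x} \<psi> = integral {-M..x} (\<lambda>_. 0)"
        by (intro integral_cong \<psi>0) auto
      then show ?thesis using \<phi>[of "-M" x] x by (simp add: \<phi>_def)
    qed
  qed
  have d: "(\<phi> has_real_derivative \<psi> x) (at x)" for x
    unfolding \<phi>_def
    using DERIV_diff[OF primitive_of_has_derivative[OF P test_function_continuous[OF \<psi>]] DERIV_const]
    by simp
  have deq: "deriv \<phi> = \<psi>"
    using d by (auto intro: DERIV_imp_deriv)
  have "\<phi> \<in> test_functions UNIV"
  proof (rule test_functionI[of _ "{-M..M}"])
    fix n x
    show "(deriv ^^ n) \<phi> differentiable (at x)"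
    proof (cases n)
      case 0
      then show ?thesis using d real_differentiable_def by auto
    next
      case (Suc m)
      then have "(deriv ^^ n) \<phi> = (deriv ^^ m) \<psi>"
        using deq by (simp add: funpow_swap1)
      then show ?thesis using \<psi> unfolding test_functions_def by auto
    qed
  qed (use \<phi>0 in auto)
  with deq show ?thesis by blast
qed

lemma test_functions_diff_scaled:
  assumes f: "f \<in> test_functions \<Omega>" and g: "g \<in> test_functions \<Omega>"
  shows "(\<lambda>x. f x - s * g x) \<in> test_functions \<Omega>"
proof -
  have df: "((deriv ^^ n) f has_real_derivative (deriv ^^ Suc n) f x) (at x)"
    and dg: "((deriv ^^ n) g has_real_derivative (deriv ^^ Suc n) g x) (at x)" for n x
    using f g by (auto simp: test_functions_def DERIV_deriv_iff_real_differentiable)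
  have eq: "(deriv ^^ n) (\<lambda>x. f x - s * g x) = (\<lambda>x. (deriv ^^ n) f x - s * (deriv ^^ n) g x)" for n
  proof (induction n)
    case (Suc n)
    have "deriv (\<lambda>x. (deriv ^^ n) f x - s * (deriv ^^ n) g x) = (\<lambda>x. (deriv ^^ Suc n) f x - s * (deriv ^^ Suc n) g x)"
      by (intro ext DERIV_imp_deriv DERIV_diff DERIV_cmult df dg)
    with Suc show ?case by simp
  qed simp
  obtain C where C: "compact C" "C \<subseteq> \<Omega>" "\<And>x. x \<notin> C \<Longrightarrow> f x = 0"
    using test_function_support[OF f] by blast
  obtain D where D: "compact D" "D \<subseteq> \<Omega>" "\<And>x. x \<notin> D \<Longrightarrow> g x = 0"
    using test_function_support[OF g] by blast
  show ?thesis
  proof (rule test_functionI[of _ "C \<union> D"])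
    fix n x
    show "(deriv ^^ n) (\<lambda>x. f x - s * g x) differentiable (at x)"
      unfolding eq using DERIV_diff[OF df DERIV_cmult[OF dg]] unfolding real_differentiable_def by blast
  qed (use C D in auto)
qed

text \<open>
  Let P be a primitive of g.  Then w = u - P satisfies \<integral> w \<phi>' = 0 for all test functions \<phi>.
  An arbitrary test function \<psi> becomes a derivative once a multiple of a fixed bump \<rho> is
  subtracted to make its mean zero; hence \<integral> (w - c) \<psi> = 0, where c is the average of w
  weighted by \<rho>, and w is constant by the fundamental lemma.
\<close>

theorem du_Bois_Reymond:
  assumes u: "continuous_on UNIV u" and ug: "has_weak_deriv 1 UNIV u g"
  shows "primitive_of u g"
proof -
  have "\<And>x y. g absolutely_integrable_on {x..y}"
    using ug by (simp add: has_weak_deriv_def locally_integrable_UNIV_iff)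
  then obtain P where P: "primitive_of P g"
    using primitive_of_exists by blast
  have cP: "continuous_on UNIV P" by (rule primitive_of_continuous[OF P])
  define w where "w = (\<lambda>x. u x - P x)"
  have cw: "continuous_on UNIV w"
    unfolding w_def by (intro continuous_intros u cP)
  have i: "integrable lebesgue (\<lambda>x. f x * \<phi> x)"
    if "continuous_on UNIV f" "\<phi> \<in> test_functions UNIV" for f \<phi>
    using integrable_mult_test_function[OF locally_integrable_continuous[OF that(1)] that(2)]
    by (simp add: lebesgue_on_UNIV_eq)
  have i1: "integrable lebesgue \<phi>" if "\<phi> \<in> test_functions UNIV" for \<phi>
    using i[OF continuous_on_const[of _ 1] that] by simp
  have w0: "(LINT x|lebesgue. w x * deriv \<phi> x) = 0" if \<phi>: "\<phi> \<in> test_functions UNIV" for \<phi>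
  proof -
    have "(LINT x|lebesgue. u x * deriv \<phi> x) = (LINT x|lebesgue. P x * deriv \<phi> x)"
      using has_weak_deriv_by_parts[OF ug \<phi>] has_weak_deriv_by_parts[OF has_weak_deriv_primitive[OF P] \<phi>]
      by (simp add: lebesgue_on_UNIV_eq)
    then show ?thesis
      using i[OF u deriv_in_test_functions[OF \<phi>]] i[OF cP deriv_in_test_functions[OF \<phi>]]
      by (simp add: w_def left_diff_distrib)
  qed
  \<comment> \<open>Any test function with nonzero integral would do.\<close>
  define \<rho> where "\<rho> = plateau 0 1 1"
  have \<rho>: "\<rho> \<in> test_functions UNIV"
    unfolding \<rho>_def by (rule plateau_test_function) simp
  define r where "r = (LINT x|lebesgue. \<rho> x)"
  have "r \<noteq> 0"
  proof
    assume "r = 0"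
    have c: "continuous_on {0..1} \<rho>"
      by (rule test_function_continuous[OF \<rho>])
    have z: "\<rho> x = 0" if "x \<in> UNIV - {0..1}" for x
    proof -
      have "x \<notin> {0<..<1}" using that by simp linarith
      then show ?thesis unfolding \<rho>_def by (rule plateau_eq_0)
    qed
    have "(LINT x|lebesgue_on UNIV. \<rho> x) = integral {0..1} \<rho>"
      by (rule lebesgue_on_integral_supported[OF _ subset_UNIV z absolutely_integrable_continuous_real[OF c]]) simp
    with \<open>r = 0\<close> have r0: "integral {0..1} \<rho> = 0"
      by (simp add: r_def lebesgue_on_UNIV_eq)
    have nn: "\<rho> x \<ge> 0" for x
      unfolding \<rho>_def by (rule plateau_bounds)
    have "\<forall>x\<in>{0..1}. \<rho> x = 0"
      by (rule integral_eq_0_iff[OF c _ nn, THEN iffD1, OF _ r0]) simp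
    then have "\<rho> (1/2) = 0" by simp
    moreover have "\<rho> (1/2) > 0" unfolding \<rho>_def by (rule plateau_pos) auto
    ultimately show False by simp
  qed
  define c where "c = (LINT x|lebesgue. w x * \<rho> x) / r"
  have li: "locally_integrable UNIV (\<lambda>x. w x - c)"
    by (intro locally_integrable_continuous continuous_intros cw)
  have "AE x in lebesgue_on UNIV. w x - c = 0"
  proof (rule fundamental_lemma_of_calculus_of_variations[OF open_UNIV li])
    fix \<psi> assume \<psi>: "\<psi> \<in> test_functions UNIV"
    define s where "s = (LINT x|lebesgue. \<psi> x) / r"
    have t: "(\<lambda>x. \<psi> x - s * \<rho> x) \<in> test_functions UNIV"
      by (rule test_functions_diff_scaled[OF \<psi> \<rho>])
    have "(LINT x|lebesgue. \<psi> x - s * \<rho> x) = (LINT x|lebesgue. \<psi> x) - s * r"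
      using i1[OF \<psi>] i1[OF \<rho>] by (simp add: r_def)
    then have "(LINT x|lebesgue. \<psi> x - s * \<rho> x) = 0"
      using \<open>r \<noteq> 0\<close> by (simp add: s_def)
    from mean_zero_test_function_is_derivative[OF t this]
    obtain \<phi> where \<phi>: "\<phi> \<in> test_functions UNIV" "deriv \<phi> = (\<lambda>x. \<psi> x - s * \<rho> x)" by blast
    have "0 = (LINT x|lebesgue. w x * \<psi> x - s * (w x * \<rho> x))"
      using w0[OF \<phi>(1)] by (simp add: \<phi>(2) algebra_simps)
    also have "\<dots> = (LINT x|lebesgue. w x * \<psi> x) - s * (LINT x|lebesgue. w x * \<rho> x)"
      using i[OF cw \<psi>] i[OF cw \<rho>] by simp
    also have "s * (LINT x|lebesgue. w x * \<rho> x) = c * (LINT x|lebesgue. \<psi> x)"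
      by (simp add: s_def c_def)
    finally have "(LINT x|lebesgue. w x * \<psi> x) - c * (LINT x|lebesgue. \<psi> x) = 0" by simp
    then show "(LINT x|lebesgue_on UNIV. (w x - c) * \<psi> x) = 0"
      using i[OF cw \<psi>] i1[OF \<psi>] by (simp add: lebesgue_on_UNIV_eq left_diff_distrib)
  qed
  then have "AE x in lebesgue_on UNIV. w x = c" by simp
  then have "AE x in lebesgue. w x = c"
    unfolding lebesgue_on_UNIV_eq .
  then have "w = (\<lambda>x. c)"
    by (intro AE_eq_continuous_imp_eq cw continuous_on_const)
  then have "u = (\<lambda>x. P x + c)"
    by (auto simp: w_def fun_eq_iff algebra_simps dest: spec)
  then show ?thesis
    using P by (simp add: primitive_of_def)
qed



section \<open>The Riccati equation and the decaying solutions\<close>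

text \<open>
  For c > 0 and bounded W this is the unique bounded solution of p' = c p - W on the line (variation of constants from
  infinity).
\<close>

definition bounded_solution :: "real \<Rightarrow> (real \<Rightarrow> real) \<Rightarrow> real \<Rightarrow> real" where
  "bounded_solution c W x = exp (c * x) * integral {x..} (\<lambda>y. exp (- c * y) * W y)"

lemma exp_weighted_absolutely_integrable:
  fixes W :: "real \<Rightarrow> real"
  assumes c: "0 < c" and W: "W \<in> borel_measurable borel" and B: "\<And>x. \<bar>W x\<bar> \<le> B"
  shows "(\<lambda>y. exp (- c * y) * W y) absolutely_integrable_on {x..}"
proof (rule measurable_bounded_by_integrable_imp_absolutely_integrable)
  have "(\<lambda>y. exp (- c * y) * W y) \<in> borel_measurable lborel"
    using W by measurable
  then have "(\<lambda>y. exp (- c * y) * W y) \<in> borel_measurable lebesgue"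
    by (rule measurable_completion)
  then show "(\<lambda>y. exp (- c * y) * W y) \<in> borel_measurable (lebesgue_on {x..})"
    by (rule measurable_restrict_space1)
  show "(\<lambda>y. exp (- c * y) * B) integrable_on {x..}"
    using integrable_on_exp_minus_to_infinity[OF c, of x] by (intro integrable_on_mult_left) simp
  show "norm (exp (- c * y) * W y) \<le> exp (- c * y) * B" for y
    using B[of y] by (simp add: abs_mult)
qed simp

lemma bounded_solution_bounds:
  fixes W :: "real \<Rightarrow> real"
  assumes c: "0 < c" and W: "W \<in> borel_measurable borel" and bounds: "\<And>x. m \<le> W x" "\<And>x. W x \<le> M"
  shows "m / c \<le> bounded_solution c W x" "bounded_solution c W x \<le> M / c"
proof -
  have hc: "((\<lambda>y. exp (- c * y) * k) has_integral (exp (- c * x) / c * k)) {x..}" for k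
    by (rule has_integral_mult_left[OF has_integral_exp_minus_to_infinity[OF c]])
  have "\<bar>W x\<bar> \<le> \<bar>m\<bar> + \<bar>M\<bar>" for x
    using bounds[of x] by linarith
  from set_lebesgue_integral_eq_integral(1)[OF exp_weighted_absolutely_integrable[OF c W this, of x]]
  have hW: "((\<lambda>y. exp (- c * y) * W y) has_integral integral {x..} (\<lambda>y. exp (- c * y) * W y)) {x..}"
    by (rule integrable_integral)
  have cancel: "exp (c * x) * (exp (- c * x) / c * k) = k / c" for k
    by (simp add: exp_minus field_simps)
  have "exp (- c * x) / c * m \<le> integral {x..} (\<lambda>y. exp (- c * y) * W y)"
    by (rule has_integral_le[OF hc hW]) (use bounds in auto)
  from mult_left_mono[OF this, of "exp (c * x)"] show "m / c \<le> bounded_solution c W x"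
    by (simp only: cancel bounded_solution_def exp_ge_zero)
  have "integral {x..} (\<lambda>y. exp (- c * y) * W y) \<le> exp (- c * x) / c * M"
    by (rule has_integral_le[OF hW hc]) (use bounds in auto)
  from mult_left_mono[OF this, of "exp (c * x)"] show "bounded_solution c W x \<le> M / c"
    by (simp only: cancel bounded_solution_def exp_ge_zero)
qed

lemma bounded_solution_primitive:
  fixes W :: "real \<Rightarrow> real"
  assumes c: "0 < c" and W: "W \<in> borel_measurable borel" and B: "\<And>x. \<bar>W x\<bar> \<le> B"
  shows "primitive_of (bounded_solution c W) (\<lambda>x. c * bounded_solution c W x - W x)"
proof -
  let ?g = "\<lambda>y. exp (- c * y) * W y"
  note ai = exp_weighted_absolutely_integrable[OF c W B]
  have ai': "?g absolutely_integrable_on {x..y}" for x y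
    by (rule set_integrable_subset[OF ai[of x]]) auto
  have J: "primitive_of (\<lambda>x. integral {x..} ?g) (\<lambda>x. - ?g x)"
    unfolding primitive_of_def
  proof (intro conjI allI impI)
    fix x y :: real
    show "(\<lambda>x. - ?g x) absolutely_integrable_on {x..y}"
      using ai'[of x y] by (simp add: set_integrable_def)
    assume le: "x \<le> y"
    have "(?g has_integral (integral {x..y} ?g + integral {y..} ?g)) ({x..y} \<union> {y..})"
    proof (rule has_integral_Un)
      show "(?g has_integral integral {x..y} ?g) {x..y}"
        by (rule integrable_integral[OF set_lebesgue_integral_eq_integral(1)[OF ai']])
      show "(?g has_integral integral {y..} ?g) {y..}"
        by (rule integrable_integral[OF set_lebesgue_integral_eq_integral(1)[OF ai]])
      have "{x..y} \<inter> {y..} = {y}" using le by auto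
      then show "negligible ({x..y} \<inter> {y..})" by simp
    qed
    moreover have "{x..y} \<union> {y..} = {x..}" using le by auto
    ultimately have "integral {x..} ?g = integral {x..y} ?g + integral {y..} ?g"
      by (simp add: integral_unique)
    then show "integral {x..y} (\<lambda>x. - ?g x) = integral {y..} ?g - integral {x..} ?g"
      by simp
  qed
  have E: "primitive_of (\<lambda>x. exp (c * x)) (\<lambda>x. c * exp (c * x))"
    by (rule primitive_of_C1) (auto intro!: derivative_eq_intros continuous_intros)
  have "(\<lambda>x. exp (c * x) * - ?g x + integral {x..} ?g * (c * exp (c * x))) = (\<lambda>x. c * bounded_solution c W x - W x)"
    by (auto simp: fun_eq_iff bounded_solution_def exp_minus)
  with primitive_of_mult[OF E J] show ?thesis
    by (simp add: bounded_solution_def[abs_def])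
qed

lemma bounded_solution_diff:
  fixes W W' :: "real \<Rightarrow> real"
  assumes c: "0 < c" and "W \<in> borel_measurable borel" "\<And>x. \<bar>W x\<bar> \<le> B"
    and "W' \<in> borel_measurable borel" "\<And>x. \<bar>W' x\<bar> \<le> B'"
  shows "bounded_solution c W x - bounded_solution c W' x = bounded_solution c (\<lambda>y. W y - W' y) x"
proof -
  note i = set_lebesgue_integral_eq_integral(1)[OF exp_weighted_absolutely_integrable[OF c]]
  have "integral {x..} (\<lambda>y. exp (- c * y) * W y - exp (- c * y) * W' y) =
      integral {x..} (\<lambda>y. exp (- c * y) * W y) - integral {x..} (\<lambda>y. exp (- c * y) * W' y)"
    by (rule Henstock_Kurzweil_Integration.integral_diff) (rule i[OF assms(2,3)] i[OF assms(4,5)])+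
  then show ?thesis
    by (simp add: bounded_solution_def right_diff_distrib)
qed

text \<open>
  The Riccati equation reads p' = c p - N(p) with N(p) = V + c p - p^2, so its bounded solutions are the
  fixed points of T(q) = \<open>bounded_solution c (N q)\<close>.  With c = 2 sqrt(v1) the function
  c t - t^2 is increasing on [sqrt(v0), sqrt(v1)] and has slope at most 2 (sqrt(v1) - sqrt(v0)) there.
  Monotonicity gives c sqrt(v0) \<le> N(q) \<le> c sqrt(v1), hence T preserves the bounds;
  the slope bound divided by c is a contraction factor below one.
\<close>

lemma riccati_solution:
  fixes V :: "real \<Rightarrow> real"
  assumes V: "V \<in> borel_measurable borel" and v0: "0 < v0" and bounds: "\<And>x. v0 \<le> V x" "\<And>x. V x \<le> v1"
  shows "\<exists>p. continuous_on UNIV p \<and> (\<forall>x. sqrt v0 \<le> p x \<and> p x \<le> sqrt v1) \<and>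
    primitive_of p (\<lambda>x. (p x)\<^sup>2 - V x)"
proof -
  \<comment> \<open>The value of c makes c t - t^2 increasing up to t = sqrt(v1).\<close>
  define k0 k1 c where "k0 = sqrt v0" and "k1 = sqrt v1" and "c = 2 * k1"
  have v01: "v0 \<le> v1" using bounds[of 0] by linarith
  have k: "0 < k0" "k0 \<le> k1" "k0\<^sup>2 = v0" "k1\<^sup>2 = v1"
    using v0 v01 by (auto simp: k0_def k1_def)
  have c: "c > 0" using k by (simp add: c_def)
  define N where "N = (\<lambda>q x. V x + c * q x - (q x)\<^sup>2)"
  define admissible where "admissible = (\<lambda>q :: real \<Rightarrow> real. continuous_on UNIV q \<and> (\<forall>x. k0 \<le> q x \<and> q x \<le> k1))"
  have Nm: "N q \<in> borel_measurable borel" if "admissible q" for q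
  proof -
    have [measurable]: "q \<in> borel_measurable borel"
      using that by (auto simp: admissible_def intro: borel_measurable_continuous_onI)
    note [measurable] = V
    show ?thesis unfolding N_def by measurable
  qed
  have Nb: "c * k0 \<le> N q x" "N q x \<le> c * k1" if "admissible q" for q x
  proof -
    have q: "k0 \<le> q x" "q x \<le> k1" using that by (auto simp: admissible_def)
    have "0 \<le> (q x - k0) * (c - (q x + k0))"
      using q k by (intro mult_nonneg_nonneg) (auto simp: c_def)
    also have "\<dots> = (c * q x - (q x)\<^sup>2) - (c * k0 - v0)"
      using k(3) by (simp add: algebra_simps power2_eq_square)
    finally show "c * k0 \<le> N q x"
      using bounds(1)[of x] by (simp add: N_def)
    have "0 \<le> (k1 - q x) * (c - (q x + k1))"
      using q k by (intro mult_nonneg_nonneg) (auto simp: c_def)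
    also have "\<dots> = (c * k1 - v1) - (c * q x - (q x)\<^sup>2)"
      using k(4) by (simp add: algebra_simps power2_eq_square)
    finally show "N q x \<le> c * k1"
      using bounds(2)[of x] by (simp add: N_def)
  qed
  have Nabs: "\<bar>N q x\<bar> \<le> c * k1" if "admissible q" for q x
  proof -
    have "0 \<le> c * k0" using c k by simp
    with Nb[OF that, of x] show ?thesis by simp
  qed
  define T where "T = (\<lambda>q. bounded_solution c (N q))"
  have Tprim: "primitive_of (T q) (\<lambda>x. c * T q x - N q x)" if "admissible q" for q
    unfolding T_def by (rule bounded_solution_primitive[OF c Nm[OF that] Nabs[OF that]])
  have Tadm: "admissible (T q)" if "admissible q" for q
    using primitive_of_continuous[OF Tprim[OF that]]
      bounded_solution_bounds[OF c Nm[OF that] Nb[OF that]] c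
    by (simp add: admissible_def T_def)
  define r where "r = (k1 - k0) / k1"
  have r: "0 \<le> r" "r < 1" using k by (auto simp: r_def)
  have contr: "\<bar>T q x - T q' x\<bar> \<le> r * d"
    if q: "admissible q" and q': "admissible q'" and d: "\<And>y. \<bar>q y - q' y\<bar> \<le> d" for q q' x d
  proof -
    have b: "\<bar>N q y - N q' y\<bar> \<le> (2 * (k1 - k0)) * d" for y
    proof -
      have y: "k0 \<le> q y" "q y \<le> k1" "k0 \<le> q' y" "q' y \<le> k1"
        using q q' by (auto simp: admissible_def)
      have "N q y - N q' y = (c - (q y + q' y)) * (q y - q' y)"
        by (simp add: N_def algebra_simps power2_eq_square)
      also have "\<bar>\<dots>\<bar> = \<bar>c - (q y + q' y)\<bar> * \<bar>q y - q' y\<bar>"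
        by (rule abs_mult)
      also have "\<dots> \<le> (2 * (k1 - k0)) * d"
        using y by (intro mult_mono d) (auto simp: c_def)
      finally show ?thesis .
    qed
    have m: "(\<lambda>y. N q y - N q' y) \<in> borel_measurable borel"
      using Nm[OF q] Nm[OF q'] by measurable
    have lo: "- ((2 * (k1 - k0)) * d) \<le> N q y - N q' y" and up: "N q y - N q' y \<le> (2 * (k1 - k0)) * d" for y
      using b[of y] by auto
    have e: "T q x - T q' x = bounded_solution c (\<lambda>y. N q y - N q' y) x"
      unfolding T_def by (rule bounded_solution_diff[OF c Nm[OF q] Nabs[OF q] Nm[OF q'] Nabs[OF q']])
    have "(2 * (k1 - k0)) * d / c = r * d" using k by (simp add: c_def r_def field_simps)
    then show ?thesis
      using bounded_solution_bounds[OF c m lo up, of x] unfolding e by (simp add: abs_le_iff)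
  qed
  \<comment> \<open>The admissible functions form a closed subset of the complete space of bounded continuous functions.\<close>
  define S :: "(real \<Rightarrow>\<^sub>C real) set" where "S = PiC UNIV (\<lambda>_. {k0..k1})"
  have S: "q \<in> S \<longleftrightarrow> admissible (apply_bcontfun q)" for q
    by (auto simp: S_def mem_PiC_iff admissible_def Pi_iff)
  have lift: "apply_bcontfun (Bcontfun q) = q" if "admissible q" for q
  proof (rule Bcontfun_inverse)
    show "q \<in> bcontfun"
    proof (rule bcontfun_normI[where b=k1])
      show "continuous_on UNIV q" using that by (simp add: admissible_def)
      show "norm (q x) \<le> k1" for x
        using that k by (auto simp: admissible_def abs_le_iff) (smt (verit))
    qed
  qed
  have "\<exists>!q\<in>S. Bcontfun (T (apply_bcontfun q)) = q"
  proof (rule Banach_fix[OF complete_eq_closed[THEN iffD2] _ r])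
    show "closed S"
      unfolding S_def by (rule closed_PiC) simp
    have "admissible (\<lambda>_. k0)" using k by (simp add: admissible_def)
    then show "S \<noteq> {}"
      using S[of "Bcontfun (\<lambda>_. k0)"] lift[of "\<lambda>_. k0"] by auto
    show "(\<lambda>q. Bcontfun (T (apply_bcontfun q))) ` S \<subseteq> S"
      using S lift Tadm by auto
    fix q q' assume q: "q \<in> S" "q' \<in> S"
    show "dist (Bcontfun (T (apply_bcontfun q))) (Bcontfun (T (apply_bcontfun q'))) \<le> r * dist q q'"
    proof (rule dist_bound)
      fix x
      have "\<bar>T (apply_bcontfun q) x - T (apply_bcontfun q') x\<bar> \<le> r * dist q q'"
        using q S dist_bounded[of q _ q'] by (intro contr) (auto simp: dist_real_def)
      then show "dist (apply_bcontfun (Bcontfun (T (apply_bcontfun q))) x)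
          (apply_bcontfun (Bcontfun (T (apply_bcontfun q'))) x) \<le> r * dist q q'"
        using q S lift Tadm by (simp add: dist_real_def)
    qed
  qed
  then obtain q where q: "q \<in> S" "Bcontfun (T (apply_bcontfun q)) = q" by blast
  define p where "p = apply_bcontfun q"
  have p: "admissible p" using q S by (simp add: p_def)
  have fixp: "T p = p"
    using lift[OF Tadm[OF p]] q(2) by (simp add: p_def)
  have "(\<lambda>x. c * p x - N p x) = (\<lambda>x. (p x)\<^sup>2 - V x)"
    by (auto simp: N_def)
  then have "primitive_of p (\<lambda>x. (p x)\<^sup>2 - V x)"
    using Tprim[OF p] by (simp add: fixp)
  then show ?thesis
    using p unfolding admissible_def k0_def k1_def by blast
qed

text \<open>
  The substitution u = exp(-P) with P' = p linearizes the Riccati equation: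
  (-p u)' = -p' u + p^2 u = V u.  The solution exists on the whole line, so that it
  can be glued at \<open>a\<close> to one that decays on the other side.
\<close>

lemma decaying_solution:
  fixes V :: "real \<Rightarrow> real"
  assumes V: "V \<in> borel_measurable borel" and v0: "0 < v0" and bounds: "\<And>x. v0 \<le> V x" "\<And>x. V x \<le> v1"
  shows "\<exists>u p. continuous_on UNIV p \<and> (\<forall>x. sqrt v0 \<le> p x \<and> p x \<le> sqrt v1) \<and>
    (\<forall>x. (u has_real_derivative - (p x * u x)) (at x)) \<and>
    primitive_of (\<lambda>x. - (p x * u x)) (\<lambda>x. V x * u x) \<and> u a = 1 \<and>
    (\<forall>x\<ge>a. exp (- sqrt v1 * (x - a)) \<le> u x \<and> u x \<le> exp (- sqrt v0 * (x - a)))"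
proof -
  obtain p where pc: "continuous_on UNIV p" and pb: "\<And>x. sqrt v0 \<le> p x" "\<And>x. p x \<le> sqrt v1"
    and pp: "primitive_of p (\<lambda>x. (p x)\<^sup>2 - V x)"
    using riccati_solution[OF V v0 bounds] by blast
  have "p absolutely_integrable_on {x..y}" for x y
    using pc continuous_on_subset by (intro absolutely_integrable_continuous_real) blast
  then obtain P where P: "primitive_of P p" using primitive_of_exists by blast
  have Pd: "(P has_real_derivative p x) (at x)" for x
    by (rule primitive_of_has_derivative[OF P pc])
  define u where "u = (\<lambda>x. exp (P a - P x))"
  have ud: "(u has_real_derivative - (p x * u x)) (at x)" for x
    unfolding u_def by (auto intro!: derivative_eq_intros Pd)
  have uc: "continuous_on UNIV u"
    by (rule DERIV_continuous_on[OF has_field_derivative_at_within[OF ud]])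
  have u: "primitive_of u (\<lambda>x. - (p x * u x))"
    by (rule primitive_of_C1[OF ud]) (intro continuous_intros pc uc)
  have "primitive_of (\<lambda>x. - p x) (\<lambda>x. - ((p x)\<^sup>2 - V x))"
    using primitive_of_diff[OF primitive_of_C1[of "\<lambda>_. 0" "\<lambda>_. 0"] pp] by simp
  from primitive_of_mult[OF this u]
  have "primitive_of (\<lambda>x. - p x * u x) (\<lambda>x. - p x * - (p x * u x) + u x * - ((p x)\<^sup>2 - V x))" .
  also have "(\<lambda>x. - p x * - (p x * u x) + u x * - ((p x)\<^sup>2 - V x)) = (\<lambda>x. V x * u x)"
    by (auto simp: algebra_simps power2_eq_square)
  finally have g: "primitive_of (\<lambda>x. - (p x * u x)) (\<lambda>x. V x * u x)" by simp
  have "exp (- sqrt v1 * (x - a)) \<le> u x \<and> u x \<le> exp (- sqrt v0 * (x - a))" if "a \<le> x" for x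
  proof -
    have "sqrt v1 * a - P a \<le> sqrt v1 * x - P x"
      by (rule DERIV_nonneg_imp_nondecreasing[OF that])
         (use pb in \<open>auto intro!: exI derivative_eq_intros Pd\<close>)
    moreover have "P a - sqrt v0 * a \<le> P x - sqrt v0 * x"
      by (rule DERIV_nonneg_imp_nondecreasing[OF that])
         (use pb in \<open>auto intro!: exI derivative_eq_intros Pd\<close>)
    ultimately show ?thesis by (simp add: u_def algebra_simps)
  qed
  moreover have "u a = 1" by (simp add: u_def)
  ultimately show ?thesis using pc pb ud g by blast
qed



section \<open>Integrability and norms\<close>

lemma Lp_2_UNIV_iff:
  "f \<in> Lp 2 UNIV \<longleftrightarrow> f \<in> borel_measurable lebesgue \<and> integrable lebesgue (\<lambda>x. (f x)\<^sup>2)"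
proof -
  have "\<bar>y\<bar> powr real_of_ereal 2 = y\<^sup>2" for y :: real
    by (cases "y = 0") simp_all
  then show ?thesis
    by (simp add: Lp_def lebesgue_on_UNIV_eq)
qed

lemma bounded_in_Lp_infinity:
  assumes "f \<in> borel_measurable lebesgue" "\<And>x. x \<in> \<Omega> \<Longrightarrow> \<bar>f x\<bar> \<le> B"
  shows "f \<in> Lp \<infinity> \<Omega>"
proof -
  have m: "f \<in> borel_measurable (lebesgue_on \<Omega>)"
    by (rule measurable_restrict_space1[OF assms(1)])
  have "esssup (lebesgue_on \<Omega>) (\<lambda>x. ereal \<bar>f x\<bar>) \<le> ereal B"
  proof (rule esssup_I)
    show "(\<lambda>x. ereal \<bar>f x\<bar>) \<in> borel_measurable (lebesgue_on \<Omega>)"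
      using m by measurable
    show "AE x in lebesgue_on \<Omega>. ereal \<bar>f x\<bar> \<le> ereal B"
      by (rule AE_I2) (use assms(2) in auto)
  qed
  then show ?thesis using m by (auto simp: Lp_def)
qed

lemma integrable_mult_L2:
  fixes f g :: "real \<Rightarrow> real"
  assumes "f \<in> borel_measurable lebesgue" "integrable lebesgue (\<lambda>x. (f x)\<^sup>2)"
    and "g \<in> borel_measurable lebesgue" "integrable lebesgue (\<lambda>x. (g x)\<^sup>2)"
  shows "integrable lebesgue (\<lambda>x. f x * g x)"
proof (rule Bochner_Integration.integrable_bound)
  show "integrable lebesgue (\<lambda>x. (f x)\<^sup>2 + (g x)\<^sup>2)"
    using assms by simp
  show "(\<lambda>x. f x * g x) \<in> borel_measurable lebesgue"
    using assms by measurable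
  have "\<bar>s * t\<bar> \<le> s\<^sup>2 + t\<^sup>2" for s t :: real
  proof -
    have "2 * (\<bar>s\<bar> * \<bar>t\<bar>) \<le> s\<^sup>2 + t\<^sup>2"
      using sum_squares_bound[of "\<bar>s\<bar>" "\<bar>t\<bar>"] by (simp add: mult.assoc)
    moreover have "0 \<le> \<bar>s\<bar> * \<bar>t\<bar>" by simp
    ultimately show ?thesis unfolding abs_mult by linarith
  qed
  then show "AE x in lebesgue. norm (f x * g x) \<le> norm ((f x)\<^sup>2 + (g x)\<^sup>2)"
    by simp
qed

lemma integrable_diff_L2:
  fixes f g :: "real \<Rightarrow> real"
  assumes "f \<in> borel_measurable lebesgue" "integrable lebesgue (\<lambda>x. (f x)\<^sup>2)"
    and "g \<in> borel_measurable lebesgue" "integrable lebesgue (\<lambda>x. (g x)\<^sup>2)"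
  shows "integrable lebesgue (\<lambda>x. (f x - g x)\<^sup>2)"
proof -
  have "integrable lebesgue (\<lambda>x. (f x)\<^sup>2 + (g x)\<^sup>2 - 2 * (f x * g x))"
    using assms integrable_mult_L2[OF assms] by simp
  then show ?thesis
    by (simp add: power2_diff mult.assoc)
qed

lemma integrable_bounded_mult:
  fixes f V :: "real \<Rightarrow> real"
  assumes "V \<in> borel_measurable lebesgue" "\<And>x. \<bar>V x\<bar> \<le> B" "integrable lebesgue f"
  shows "integrable lebesgue (\<lambda>x. V x * f x)"
proof (rule Bochner_Integration.integrable_bound)
  show "integrable lebesgue (\<lambda>x. B * f x)" using assms by simp
  show "(\<lambda>x. V x * f x) \<in> borel_measurable lebesgue"
    using assms by measurable
  have "B \<ge> 0" using assms(2)[of 0] by linarith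
  then show "AE x in lebesgue. norm (V x * f x) \<le> norm (B * f x)"
    using assms(2) by (simp add: abs_mult mult_right_mono)
qed

text \<open>
  Dominated by two reflected copies of a one-sided exponential.
\<close>

lemma integrable_exp_abs:
  assumes k: "0 < (k::real)"
  shows "integrable lebesgue (\<lambda>x. exp (- k * \<bar>x - a\<bar>))"
proof -
  define f where "f = (\<lambda>x. indicat_real {0..} x *\<^sub>R exp (- k * x))"
  have "(\<lambda>x. exp (- k * x)) absolutely_integrable_on {0..}"
    by (rule nonnegative_absolutely_integrable_1[OF integrable_on_exp_minus_to_infinity[OF k]]) simp
  then have f: "integrable lebesgue f"
    by (simp add: f_def set_integrable_def)
  have "integrable lebesgue (\<lambda>x. f (- a + 1 * x) + f (a + (-1) * x))"
    by (intro Bochner_Integration.integrable_add lebesgue_integrable_real_affine f) simp_all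
  then show ?thesis
  proof (rule Bochner_Integration.integrable_bound)
    have "(\<lambda>x. exp (- k * \<bar>x - a\<bar>)) \<in> borel_measurable lborel" by measurable
    then show "(\<lambda>x. exp (- k * \<bar>x - a\<bar>)) \<in> borel_measurable lebesgue"
      by (rule measurable_completion)
    have "exp (- k * \<bar>x - a\<bar>) \<le> f (- a + 1 * x) + f (a + (-1) * x)" for x
      by (cases "a \<le> x") (auto simp: f_def indicator_def algebra_simps)
    moreover have "0 \<le> f (- a + 1 * x) + f (a + (-1) * x)" for x
      by (simp add: f_def)
    ultimately show "AE x in lebesgue. norm (exp (- k * \<bar>x - a\<bar>)) \<le> norm (f (- a + 1 * x) + f (a + (-1) * x))"
      by (intro AE_I2) (simp add: abs_of_nonneg)
  qed
qed

lemma exp_abs_tendsto_0: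
  assumes k: "0 < (k::real)"
  shows "((\<lambda>x. exp (- k * \<bar>x - a\<bar>)) \<longlongrightarrow> 0) at_top" "((\<lambda>x. exp (- k * \<bar>x - a\<bar>)) \<longlongrightarrow> 0) at_bot"
proof -
  have *: "((\<lambda>x. exp (- k * \<bar>x - a\<bar>)) \<longlongrightarrow> 0) L" if "filterlim (\<lambda>x. \<bar>x - a\<bar>) at_top L" for L
  proof -
    have "filterlim (\<lambda>x. k * \<bar>x - a\<bar>) at_top L"
      by (rule filterlim_tendsto_pos_mult_at_top[OF tendsto_const k that])
    then have "filterlim (\<lambda>x. - (k * \<bar>x - a\<bar>)) at_bot L"
      by (rule filterlim_compose[OF filterlim_uminus_at_bot_at_top])
    from filterlim_compose[OF exp_at_bot this] show ?thesis by simp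
  qed
  have "filterlim (\<lambda>x. - a + x) at_top at_top"
    by (rule filterlim_tendsto_add_at_top[OF tendsto_const filterlim_ident])
  then show "((\<lambda>x. exp (- k * \<bar>x - a\<bar>)) \<longlongrightarrow> 0) at_top"
    by (intro *, elim filterlim_at_top_mono) (rule always_eventually, auto)
  have "filterlim (\<lambda>x. a + - x) at_top at_bot"
    by (rule filterlim_tendsto_add_at_top[OF tendsto_const filterlim_uminus_at_top_at_bot])
  then show "((\<lambda>x. exp (- k * \<bar>x - a\<bar>)) \<longlongrightarrow> 0) at_bot"
    by (intro *, elim filterlim_at_top_mono) (rule always_eventually, auto)
qed

text \<open>
  For a continuous function the essential supremum bounds every value: the set where it is
  exceeded would be open and negligible.
\<close>

lemma continuous_le_Linf_norm:
  assumes "continuous_on UNIV u"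
  shows "ereal \<bar>u x\<bar> \<le> Linf_norm u"
proof (rule ccontr)
  assume neg: "\<not> ereal \<bar>u x\<bar> \<le> Linf_norm u"
  let ?S = "{x. Linf_norm u < ereal \<bar>u x\<bar>}"
  have "AE x in lebesgue. ereal \<bar>u x\<bar> \<le> Linf_norm u"
    unfolding Linf_norm_def by (rule esssup_AE)
  then have "negligible ?S"
    by (auto simp: eventually_ae_filter_negligible not_le[symmetric] intro: negligible_subset)
  moreover have "open ?S"
    by (intro open_Collect_less continuous_intros continuous_on_ereal assms)
  ultimately show False
    using neg open_not_negligible by (metis (no_types, lifting) empty_iff mem_Collect_eq not_le)
qed

lemma Linf_norm_eq_1:
  assumes "continuous_on UNIV u" "\<And>x. \<bar>u x\<bar> \<le> 1" "u a = 1"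
  shows "Linf_norm u = 1"
proof (rule antisym)
  have "(\<lambda>x. ereal \<bar>u x\<bar>) \<in> borel_measurable lborel"
    using borel_measurable_continuous_onI[OF assms(1)] by measurable
  then have "(\<lambda>x. ereal \<bar>u x\<bar>) \<in> borel_measurable lebesgue"
    by (rule measurable_completion)
  then show "Linf_norm u \<le> 1"
    unfolding Linf_norm_def by (rule esssup_I) (use assms(2) in auto)
  show "1 \<le> Linf_norm u"
    using continuous_le_Linf_norm[OF assms(1), of a] assms(3) by (simp add: one_ereal_def)
qed

section \<open>The minimizer\<close>

text \<open>
  The energy refers to an arbitrarily chosen weak derivative and to V up to null sets; both may be
  replaced by convenient representatives.
\<close>

lemma energy_eq:
  assumes "has_weak_deriv 1 UNIV u g" and [measurable]: "g \<in> borel_measurable lebesgue" "u \<in> borel_measurable lebesgue"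
    "V \<in> borel_measurable lebesgue" "W \<in> borel_measurable lebesgue" and VW: "AE x in lebesgue. V x = W x"
  shows "energy V u = (LINT x|lebesgue. (g x)\<^sup>2 + W x * (u x)\<^sup>2)"
proof -
  have ae: "AE x in lebesgue. g x = weak_deriv 1 UNIV u x"
    using weak_deriv_AE_eq[OF open_UNIV assms(1)] unfolding lebesgue_on_UNIV_eq
    by eventually_elim simp
  have [measurable]: "weak_deriv 1 UNIV u \<in> borel_measurable lebesgue"
    by (rule borel_measurable_AE[OF assms(2) ae])
  show ?thesis
    unfolding energy_def
  proof (rule integral_cong_AE)
    show "AE x in lebesgue. \<bar>weak_deriv 1 UNIV u x\<bar>\<^sup>2 + V x * \<bar>u x\<bar>\<^sup>2 = (g x)\<^sup>2 + W x * (u x)\<^sup>2"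
      using ae VW by eventually_elim simp
  qed measurable
qed

text \<open>
  Truncation turns the bounds that hold almost everywhere into bounds that hold at every point, which the
  fixed point argument requires; a Borel representative remains measurable under reflection.
\<close>

lemma clamp_borel_version:
  fixes V :: "real \<Rightarrow> real"
  assumes "V \<in> borel_measurable lebesgue" "v0 \<le> v1" "AE x in lebesgue. v0 \<le> V x \<and> V x \<le> v1"
  shows "\<exists>W\<in>borel_measurable borel. (\<forall>x. v0 \<le> W x \<and> W x \<le> v1) \<and> (AE x in lebesgue. V x = W x)"
proof -
  obtain V' where V': "V' \<in> borel_measurable lborel" "AE x in lborel. V x = V' x"
    using completion_ex_borel_measurable_real[OF assms(1)] by blast
  have "AE x in lebesgue. V x = V' x"
    using V'(2) by (rule AE_completion)
  then have "AE x in lebesgue. V x = max v0 (min v1 (V' x))"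
    using assms(3) by eventually_elim auto
  moreover have "(\<lambda>x. max v0 (min v1 (V' x))) \<in> borel_measurable borel"
    using V'(1) by measurable
  ultimately show ?thesis
    using assms(2) by (intro bexI[of _ "\<lambda>x. max v0 (min v1 (V' x))"]) auto
qed

text \<open>
  The left solution is the reflection at \<open>a\<close> of the right solution for the reflected potential.
\<close>

lemma two_sided_solution:
  fixes V :: "real \<Rightarrow> real"
  assumes V: "V \<in> borel_measurable borel" and v0: "0 < v0" and bounds: "\<And>x. v0 \<le> V x" "\<And>x. V x \<le> v1"
  obtains uR gR uL gL where
    "\<forall>x. (uR has_real_derivative gR x) (at x)" "\<forall>x. (uL has_real_derivative gL x) (at x)"
    "primitive_of gR (\<lambda>x. V x * uR x)" "primitive_of gL (\<lambda>x. V x * uL x)" "uR a = 1" "uL a = 1"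
    "\<forall>x\<ge>a. exp (- sqrt v1 * \<bar>x - a\<bar>) \<le> uR x \<and> uR x \<le> exp (- sqrt v0 * \<bar>x - a\<bar>)"
    "\<forall>x\<le>a. exp (- sqrt v1 * \<bar>x - a\<bar>) \<le> uL x \<and> uL x \<le> exp (- sqrt v0 * \<bar>x - a\<bar>)"
    "\<forall>x\<ge>a. sqrt v0 * uR x \<le> - gR x \<and> - gR x \<le> sqrt v1 * uR x"
    "\<forall>x\<le>a. sqrt v0 * uL x \<le> gL x \<and> gL x \<le> sqrt v1 * uL x"
proof -
  have V': "(\<lambda>x. V (2 * a - x)) \<in> borel_measurable borel"
    using V by measurable
  obtain uR pR where "continuous_on UNIV pR" and R: "\<forall>x. sqrt v0 \<le> pR x \<and> pR x \<le> sqrt v1"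
    "\<forall>x. (uR has_real_derivative - (pR x * uR x)) (at x)"
    "primitive_of (\<lambda>x. - (pR x * uR x)) (\<lambda>x. V x * uR x)" "uR a = 1"
    "\<forall>x\<ge>a. exp (- sqrt v1 * (x - a)) \<le> uR x \<and> uR x \<le> exp (- sqrt v0 * (x - a))"
    using decaying_solution[OF V v0 bounds, of a] by (elim exE conjE) (rule that)
  obtain u p where "continuous_on UNIV p" and L: "\<forall>x. sqrt v0 \<le> p x \<and> p x \<le> sqrt v1"
    "\<forall>x. (u has_real_derivative - (p x * u x)) (at x)"
    "primitive_of (\<lambda>x. - (p x * u x)) (\<lambda>x. V (2 * a - x) * u x)" "u a = 1"
    "\<forall>x\<ge>a. exp (- sqrt v1 * (x - a)) \<le> u x \<and> u x \<le> exp (- sqrt v0 * (x - a))"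
    using decaying_solution[OF V' v0 bounds, of a] by (elim exE conjE) (rule that)
  define uL gL where "uL = (\<lambda>x. u (2 * a - x))" and "gL = (\<lambda>x. p (2 * a - x) * u (2 * a - x))"
  have pos: "0 \<le> uR x" if "a \<le> x" for x
    using R(5) that by (meson exp_ge_zero order_trans)
  have pos': "0 \<le> u x" if "a \<le> x" for x
    using L(5) that by (meson exp_ge_zero order_trans)
  show thesis
  proof (rule that[of uR "\<lambda>x. - (pR x * uR x)" uL gL])
    show "\<forall>x. (uL has_real_derivative gL x) (at x)"
      unfolding uL_def gL_def
      by (intro allI, rule DERIV_chain2[OF L(2)[rule_format], THEN DERIV_cong]) (auto intro!: derivative_eq_intros)
    have "primitive_of (\<lambda>x. - (p (2 * a - x) * u (2 * a - x))) (\<lambda>x. - (V (2 * a - (2 * a - x)) * u (2 * a - x)))"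
      by (rule primitive_of_reflect[OF L(3)])
    from primitive_of_diff[OF primitive_of_C1[of "\<lambda>_. 0" "\<lambda>_. 0"] this]
    show "primitive_of gL (\<lambda>x. V x * uL x)" by (simp add: uL_def gL_def)
    show "uL a = 1" using L(4) by (simp add: uL_def)
    show "\<forall>x\<le>a. exp (- sqrt v1 * \<bar>x - a\<bar>) \<le> uL x \<and> uL x \<le> exp (- sqrt v0 * \<bar>x - a\<bar>)"
    proof (intro allI impI)
      fix x assume that: "x \<le> a"
      show "exp (- sqrt v1 * \<bar>x - a\<bar>) \<le> uL x \<and> uL x \<le> exp (- sqrt v0 * \<bar>x - a\<bar>)"
        using L(5)[rule_format, of "2 * a - x"] that by (simp add: uL_def algebra_simps)
    qed
    show "\<forall>x\<ge>a. exp (- sqrt v1 * \<bar>x - a\<bar>) \<le> uR x \<and> uR x \<le> exp (- sqrt v0 * \<bar>x - a\<bar>)"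
    proof (intro allI impI)
      fix x assume that: "a \<le> x"
      show "exp (- sqrt v1 * \<bar>x - a\<bar>) \<le> uR x \<and> uR x \<le> exp (- sqrt v0 * \<bar>x - a\<bar>)"
        using R(5)[rule_format, of x] that by simp
    qed
    show "\<forall>x\<le>a. sqrt v0 * uL x \<le> gL x \<and> gL x \<le> sqrt v1 * uL x"
    proof (intro allI impI)
      fix x assume that: "x \<le> a"
      show "sqrt v0 * uL x \<le> gL x \<and> gL x \<le> sqrt v1 * uL x"
        using L(1) pos'[of "2 * a - x"] that by (auto simp: uL_def gL_def intro: mult_right_mono)
    qed
    show "\<forall>x\<ge>a. sqrt v0 * uR x \<le> - (- (pR x * uR x)) \<and> - (- (pR x * uR x)) \<le> sqrt v1 * uR x"
    proof (intro allI impI)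
      fix x assume that: "a \<le> x"
      show "sqrt v0 * uR x \<le> - (- (pR x * uR x)) \<and> - (- (pR x * uR x)) \<le> sqrt v1 * uR x"
        using R(1) pos[of x] that by (auto intro: mult_right_mono)
    qed
  qed (use R in auto)
qed

text \<open>
  What the constraint set provides about a competitor: it is the integral of a square integrable
  derivative, and the norm constraint holds pointwise.
\<close>

lemma K_memberE:
  assumes "w \<in> K a"
  obtains w' where "primitive_of w w'" "has_weak_deriv 1 UNIV w w'" "continuous_on UNIV w" "w a = 1" "\<forall>x. \<bar>w x\<bar> \<le> 1"
    "w \<in> borel_measurable lebesgue" "integrable lebesgue (\<lambda>x. (w x)\<^sup>2)"
    "w' \<in> borel_measurable lebesgue" "integrable lebesgue (\<lambda>x. (w' x)\<^sup>2)"
proof -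
  have w: "w \<in> sobolev 1 2 UNIV" "continuous_on UNIV w" "ereal (w a) = Linf_norm w" "Linf_norm w = 1"
    using assms by (auto simp: K_def H1_def)
  from w(1) have w2: "w \<in> Lp 2 UNIV" and "\<exists>g\<in>Lp 2 UNIV. has_weak_deriv 1 UNIV w g"
    by (auto simp: sobolev_def)
  then obtain w' where w': "w' \<in> Lp 2 UNIV" "has_weak_deriv 1 UNIV w w'" by blast
  show thesis
  proof (rule that[of w'])
    show "primitive_of w w'" by (rule du_Bois_Reymond[OF w(2) w'(2)])
    show "w a = 1" using w(3,4) by (metis ereal.inject one_ereal_def)
    show "\<forall>x. \<bar>w x\<bar> \<le> 1"
      using continuous_le_Linf_norm[OF w(2)] w(4) by (simp add: one_ereal_def)
  qed (use w(2) w'(2) w2[unfolded Lp_2_UNIV_iff] w'(1)[unfolded Lp_2_UNIV_iff] in blast)+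
qed

text \<open>
  The bounds on the derivative appear here in terms of u itself, in the stronger form that the
  Riccati equation provides; the exponential bounds follow by inserting those on u.
\<close>

theorem constrained_minimizer:
  fixes V :: "real \<Rightarrow> real" and v0 v1 a :: real
  assumes VL: "V \<in> borel_measurable lebesgue" and v0: "0 < v0"
    and Vae: "AE x in lebesgue. v0 \<le> V x \<and> V x \<le> v1"
  shows "\<exists>u. (\<forall>w. is_arg_min (energy V) (\<lambda>w. w \<in> K a) w \<longleftrightarrow> w = u) \<and>
    u \<in> W2inf (- {a}) \<and> (AE x in lebesgue_on (- {a}). weak_deriv 2 (- {a}) u x = V x * u x) \<and>
    (\<forall>x. exp (- sqrt v1 * \<bar>x - a\<bar>) \<le> u x \<and> u x \<le> exp (- sqrt v0 * \<bar>x - a\<bar>)) \<and>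
    (\<forall>x. x \<noteq> a \<longrightarrow> sqrt v0 * u x \<le> sgn (a - x) * deriv u x \<and> sgn (a - x) * deriv u x \<le> sqrt v1 * u x)"
proof -
  \<comment> \<open>Two bounds that hold almost everywhere hold together at some point, so v0 \<le> v1.\<close>
  have "\<not> (AE x in (lebesgue :: real measure). False)"
    by (simp add: eventually_ae_filter_negligible) (use non_negligible_UNIV negligible_subset in blast)
  moreover have "AE x in (lebesgue :: real measure). False" if "\<not> v0 \<le> v1"
    using Vae by eventually_elim (use that in linarith)
  ultimately have v01: "v0 \<le> v1" by blast
  obtain W where WB: "W \<in> borel_measurable borel" and Wb: "\<And>x. v0 \<le> W x" "\<And>x. W x \<le> v1"
    and VW: "AE x in lebesgue. V x = W x"
    using clamp_borel_version[OF VL v01 Vae] by blast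
  have WL: "W \<in> borel_measurable lebesgue"
    by (rule measurable_completion) (use WB in simp)
  have Wabs: "\<bar>W x\<bar> \<le> v1" for x
    using Wb[of x] v0 by simp
  obtain uR gR uL gL where
    dR: "\<forall>x. (uR has_real_derivative gR x) (at x)" and dL: "\<forall>x. (uL has_real_derivative gL x) (at x)"
    and gR: "primitive_of gR (\<lambda>x. W x * uR x)" and gL: "primitive_of gL (\<lambda>x. W x * uL x)"
    and aR: "uR a = 1" and aL: "uL a = 1"
    and bR: "\<forall>x\<ge>a. exp (- sqrt v1 * \<bar>x - a\<bar>) \<le> uR x \<and> uR x \<le> exp (- sqrt v0 * \<bar>x - a\<bar>)"
    and bL: "\<forall>x\<le>a. exp (- sqrt v1 * \<bar>x - a\<bar>) \<le> uL x \<and> uL x \<le> exp (- sqrt v0 * \<bar>x - a\<bar>)"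
    and gbR: "\<forall>x\<ge>a. sqrt v0 * uR x \<le> - gR x \<and> - gR x \<le> sqrt v1 * uR x"
    and gbL: "\<forall>x\<le>a. sqrt v0 * uL x \<le> gL x \<and> gL x \<le> sqrt v1 * uL x"
    using two_sided_solution[OF WB v0 Wb, of a] .
  note dR = dR[rule_format] and dL = dL[rule_format] and bR = bR[rule_format] and bL = bL[rule_format]
    and gbR = gbR[rule_format] and gbL = gbL[rule_format]
  define u g where "u = (\<lambda>x. if a \<le> x then uR x else uL x)" and "g = (\<lambda>x. if a \<le> x then gR x else gL x)"
  have cgR: "continuous_on UNIV gR" and cgL: "continuous_on UNIV gL"
    using gR gL primitive_of_continuous by blast+
  have pR: "primitive_of uR gR" and pL: "primitive_of uL gL"
    by (rule primitive_of_C1[OF dR cgR], rule primitive_of_C1[OF dL cgL])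
  have u: "primitive_of u g"
    unfolding u_def g_def by (rule primitive_of_glue[OF pL pR]) (simp add: aL aR)
  have cu: "continuous_on UNIV u" by (rule primitive_of_continuous[OF u])
  have ua: "u a = 1" by (simp add: u_def aR)
  have ub: "exp (- sqrt v1 * \<bar>x - a\<bar>) \<le> u x" "u x \<le> exp (- sqrt v0 * \<bar>x - a\<bar>)" for x
    using bR[of x] bL[of x] by (auto simp: u_def)
  have u0: "0 \<le> u x" for x using ub(1)[of x] by (meson exp_ge_zero order_trans)
  have u1: "u x \<le> 1" for x
  proof -
    have "exp (- sqrt v0 * \<bar>x - a\<bar>) \<le> 1" using v0 by simp
    with ub(2)[of x] show ?thesis by linarith
  qed
  have gb: "sqrt v0 * u x \<le> sgn (a - x) * g x" "sgn (a - x) * g x \<le> sqrt v1 * u x" if "x \<noteq> a" for x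
    using gbR[of x] gbL[of x] that by (auto simp: u_def g_def sgn_if)
  have gabs: "\<bar>g x\<bar> \<le> sqrt v1 * u x" for x
  proof (cases "a \<le> x")
    case True
    have "0 \<le> sqrt v0 * uR x" using u0[of x] True v0 by (simp add: u_def)
    with gbR[OF True] show ?thesis using True by (simp add: u_def g_def)
  next
    case False
    have "0 \<le> sqrt v0 * uL x" using u0[of x] False v0 by (simp add: u_def)
    with gbL[of x] show ?thesis using False by (simp add: u_def g_def)
  qed
  have du: "(u has_real_derivative g x) (at x)" if "x \<noteq> a" for x
  proof (cases "a < x")
    case True
    have "(uR has_real_derivative g x) (at x)" using dR[of x] True by (simp add: g_def)
    then show ?thesis
      by (rule has_field_derivative_transform_within_open[where S="{a<..}"]) (use True in \<open>auto simp: u_def\<close>)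
  next
    case False
    with that have lt: "x < a" by simp
    have "(uL has_real_derivative g x) (at x)" using dL[of x] lt by (simp add: g_def)
    then show ?thesis
      by (rule has_field_derivative_transform_within_open[where S="{..<a}"]) (use lt in \<open>auto simp: u_def\<close>)
  qed
  have uL: "u \<in> borel_measurable lebesgue"
    by (rule measurable_completion) (use borel_measurable_continuous_onI[OF cu] in simp)
  have gL': "g \<in> borel_measurable lebesgue"
  proof (rule measurable_completion)
    have [measurable]: "gR \<in> borel_measurable borel" "gL \<in> borel_measurable borel"
      using cgR cgL by (auto intro: borel_measurable_continuous_onI)
    show "g \<in> borel_measurable lborel" unfolding g_def by measurable
  qed
  have expi: "integrable lebesgue (\<lambda>x. exp (- sqrt v0 * \<bar>x - a\<bar>))"
    by (rule integrable_exp_abs) (use v0 in simp)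
  have u2: "integrable lebesgue (\<lambda>x. (u x)\<^sup>2)"
  proof (rule Bochner_Integration.integrable_bound[OF expi])
    show "(\<lambda>x. (u x)\<^sup>2) \<in> borel_measurable lebesgue" using uL by measurable
    have "(u x)\<^sup>2 \<le> u x" for x
      using mult_left_le[OF u1[of x] u0[of x]] by (simp add: power2_eq_square)
    then show "AE x in lebesgue. norm ((u x)\<^sup>2) \<le> norm (exp (- sqrt v0 * \<bar>x - a\<bar>))"
      using ub(2) by (intro AE_I2) (simp, meson order_trans)
  qed
  have g2: "integrable lebesgue (\<lambda>x. (g x)\<^sup>2)"
  proof (rule Bochner_Integration.integrable_bound)
    show "integrable lebesgue (\<lambda>x. v1 * (u x)\<^sup>2)" using u2 by simp
    show "(\<lambda>x. (g x)\<^sup>2) \<in> borel_measurable lebesgue" using gL' by measurable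
    have "(g x)\<^sup>2 \<le> v1 * (u x)\<^sup>2" for x
      using power_mono[OF gabs[of x], of 2] v0 v01 by (simp add: power_mult_distrib)
    then show "AE x in lebesgue. norm ((g x)\<^sup>2) \<le> norm (v1 * (u x)\<^sup>2)"
      by (intro AE_I2) (simp, meson abs_ge_self order_trans)
  qed
  have wd1: "has_weak_deriv 1 UNIV u g" by (rule has_weak_deriv_primitive[OF u])
  have uK: "u \<in> K a"
  proof -
    have "u \<in> Lp 2 UNIV" "g \<in> Lp 2 UNIV"
      using uL u2 gL' g2 unfolding Lp_2_UNIV_iff by blast+
    then have "u \<in> H1"
      using wd1 cu by (auto simp: H1_def sobolev_def)
    moreover have "Linf_norm u = 1"
      by (rule Linf_norm_eq_1[OF cu _ ua]) (use u0 u1 in \<open>simp add: abs_of_nonneg\<close>)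
    ultimately show ?thesis
      using ua by (simp add: K_def one_ereal_def)
  qed
  have tail: "(u \<longlongrightarrow> 0) at_top" "(u \<longlongrightarrow> 0) at_bot"
  proof -
    have k: "sqrt v0 > 0" using v0 by simp
    have le: "norm (u x) \<le> exp (- sqrt v0 * \<bar>x - a\<bar>)" for x
      using u0[of x] ub(2)[of x] by simp
    show "(u \<longlongrightarrow> 0) at_top" "(u \<longlongrightarrow> 0) at_bot"
      by (rule Lim_null_comparison[OF always_eventually exp_abs_tendsto_0(1)[OF k]], use le in blast)
         (rule Lim_null_comparison[OF always_eventually exp_abs_tendsto_0(2)[OF k]], use le in blast)
  qed
  have minimal: "energy V u \<le> energy V w \<and> (energy V w \<le> energy V u \<longrightarrow> w = u)" if wK: "w \<in> K a" for w
  proof -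
    obtain w' where w: "primitive_of w w'" "has_weak_deriv 1 UNIV w w'" "continuous_on UNIV w" "w a = 1" "\<forall>x. \<bar>w x\<bar> \<le> 1"
      and wm: "w \<in> borel_measurable lebesgue" "integrable lebesgue (\<lambda>x. (w x)\<^sup>2)"
      and w'm: "w' \<in> borel_measurable lebesgue" "integrable lebesgue (\<lambda>x. (w' x)\<^sup>2)"
      using K_memberE[OF wK] .
    define h k where "h = (\<lambda>x. w x - u x)" and "k = (\<lambda>x. w' x - g x)"
    have hk: "primitive_of h k"
      unfolding h_def k_def by (rule primitive_of_diff[OF w(1) u])
    have hm: "h \<in> borel_measurable lebesgue" and km: "k \<in> borel_measurable lebesgue"
      unfolding h_def k_def using uL gL' wm w'm by measurable
    have h2: "integrable lebesgue (\<lambda>x. (h x)\<^sup>2)"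
      unfolding h_def by (rule integrable_diff_L2[OF wm uL u2])
    have k2: "integrable lebesgue (\<lambda>x. (k x)\<^sup>2)"
      unfolding k_def by (rule integrable_diff_L2[OF w'm gL' g2])
    have i1: "integrable lebesgue (\<lambda>x. (g x)\<^sup>2 + W x * (u x)\<^sup>2)"
      by (intro Bochner_Integration.integrable_add g2 integrable_bounded_mult[OF WL Wabs] u2)
    have i2: "integrable lebesgue (\<lambda>x. g x * k x + W x * (u x * h x))"
      by (intro Bochner_Integration.integrable_add integrable_bounded_mult[OF WL Wabs]
           integrable_mult_L2[OF gL' g2 km k2] integrable_mult_L2[OF uL u2 hm h2])
    have i3: "integrable lebesgue (\<lambda>x. (k x)\<^sup>2 + W x * (h x)\<^sup>2)"
      by (intro Bochner_Integration.integrable_add k2 integrable_bounded_mult[OF WL Wabs] h2)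
    \<comment> \<open>The constraint forces all competitors to agree at the point where g jumps.\<close>
    have ha: "h a = 0" using w(4) ua by (simp add: h_def)
    \<comment> \<open>The mixed term is the total derivative of g h on either side of the jump.\<close>
    have cross: "(LINT x|lebesgue. g x * k x + W x * (u x * h x)) = 0"
    proof (rule primitive_of_integral_UNIV[OF _ i2])
      have "primitive_of (\<lambda>x. if a \<le> x then gR x * h x else gL x * h x)
        (\<lambda>x. if a \<le> x then gR x * k x + h x * (W x * uR x) else gL x * k x + h x * (W x * uL x))"
        by (intro primitive_of_glue primitive_of_mult gL gR hk) (simp add: ha)
      moreover have "(\<lambda>x. if a \<le> x then gR x * h x else gL x * h x) = (\<lambda>x. g x * h x)"
        by (auto simp: g_def)
      moreover have "(\<lambda>x. if a \<le> x then gR x * k x + h x * (W x * uR x) else gL x * k x + h x * (W x * uL x))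
          = (\<lambda>x. g x * k x + W x * (u x * h x))"
        by (auto simp: g_def u_def)
      ultimately show "primitive_of (\<lambda>x. g x * h x) (\<lambda>x. g x * k x + W x * (u x * h x))"
        by simp
      have bound: "norm (g x * h x) \<le> sqrt v1 * u x * 2" for x
      proof -
        have "\<bar>h x\<bar> \<le> 2" using w(5)[rule_format, of x] u0[of x] u1[of x] by (simp add: h_def)
        then have "\<bar>g x\<bar> * \<bar>h x\<bar> \<le> (sqrt v1 * u x) * 2"
          by (intro mult_mono gabs) (use gabs[of x] in auto)
        then show ?thesis by (simp add: abs_mult)
      qed
      have "((\<lambda>x. sqrt v1 * u x * 2) \<longlongrightarrow> sqrt v1 * 0 * 2) at_top"
        by (intro tendsto_intros tail)
      then have "((\<lambda>x. sqrt v1 * u x * 2) \<longlongrightarrow> 0) at_top"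
        by (simp only: mult_zero_left mult_zero_right)
      then show "((\<lambda>x. g x * h x) \<longlongrightarrow> 0) at_top"
        by (rule Lim_null_comparison[OF always_eventually[OF allI[OF bound]]])
      have "((\<lambda>x. sqrt v1 * u x * 2) \<longlongrightarrow> sqrt v1 * 0 * 2) at_bot"
        by (intro tendsto_intros tail)
      then have "((\<lambda>x. sqrt v1 * u x * 2) \<longlongrightarrow> 0) at_bot"
        by (simp only: mult_zero_left mult_zero_right)
      then show "((\<lambda>x. g x * h x) \<longlongrightarrow> 0) at_bot"
        by (rule Lim_null_comparison[OF always_eventually[OF allI[OF bound]]])
    qed
    have i2': "integrable lebesgue (\<lambda>x. 2 * (g x * k x + W x * (u x * h x)))"
      by (rule Bochner_Integration.integrable_mult_right) (rule i2)
    have double: "(LINT x|lebesgue. 2 * (g x * k x + W x * (u x * h x))) = 2 * (LINT x|lebesgue. g x * k x + W x * (u x * h x))"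
      by (rule Bochner_Integration.integral_mult_right_zero)
    have eu: "energy V u = (LINT x|lebesgue. (g x)\<^sup>2 + W x * (u x)\<^sup>2)"
      by (rule energy_eq[OF wd1 gL' uL VL WL VW])
    have "energy V w = (LINT x|lebesgue. (w' x)\<^sup>2 + W x * (w x)\<^sup>2)"
      by (rule energy_eq[OF w(2) w'm(1) wm(1) VL WL VW])
    also have "(\<lambda>x. (w' x)\<^sup>2 + W x * (w x)\<^sup>2) =
        (\<lambda>x. ((g x)\<^sup>2 + W x * (u x)\<^sup>2) + 2 * (g x * k x + W x * (u x * h x)) + ((k x)\<^sup>2 + W x * (h x)\<^sup>2))"
      by (auto simp: fun_eq_iff h_def k_def power2_eq_square algebra_simps)
    also have "(LINT x|lebesgue. ((g x)\<^sup>2 + W x * (u x)\<^sup>2) + 2 * (g x * k x + W x * (u x * h x)) + ((k x)\<^sup>2 + W x * (h x)\<^sup>2))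
      = (LINT x|lebesgue. (g x)\<^sup>2 + W x * (u x)\<^sup>2) + 2 * (LINT x|lebesgue. g x * k x + W x * (u x * h x))
        + (LINT x|lebesgue. (k x)\<^sup>2 + W x * (h x)\<^sup>2)"
      using Bochner_Integration.integral_add[OF Bochner_Integration.integrable_add[OF i1 i2'] i3]
        Bochner_Integration.integral_add[OF i1 i2'] double by linarith
    finally have ew: "energy V w = energy V u + (LINT x|lebesgue. (k x)\<^sup>2 + W x * (h x)\<^sup>2)"
      using cross eu by simp
    have W0: "0 \<le> W x * (h x)\<^sup>2" for x
      using Wb(1)[of x] v0 by simp
    then have nn: "0 \<le> (k x)\<^sup>2 + W x * (h x)\<^sup>2" for x
      by (simp add: add_nonneg_nonneg)
    have Q0: "0 \<le> (LINT x|lebesgue. (k x)\<^sup>2 + W x * (h x)\<^sup>2)"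
      by (rule Bochner_Integration.integral_nonneg[OF nn])
    have "w = u" if "energy V w \<le> energy V u"
    proof -
      have "(LINT x|lebesgue. (k x)\<^sup>2 + W x * (h x)\<^sup>2) = 0" using that ew Q0 by linarith
      then have "AE x in lebesgue. (k x)\<^sup>2 + W x * (h x)\<^sup>2 = 0"
        using integral_nonneg_eq_0_iff_AE[OF i3] nn by simp
      then have "AE x in lebesgue. w x = u x"
      proof eventually_elim
        case (elim x)
        then have "W x * (h x)\<^sup>2 = 0"
          using W0[of x] zero_le_power2[of "k x"] by linarith
        moreover have "W x \<noteq> 0" using Wb(1)[of x] v0 by simp
        ultimately show "w x = u x" by (simp add: h_def)
      qed
      then show ?thesis by (rule AE_eq_continuous_imp_eq[OF w(3) cu])
    qed
    then show ?thesis using ew Q0 by simp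
  qed
  have argmin: "is_arg_min (energy V) (\<lambda>w. w \<in> K a) w \<longleftrightarrow> w = u" for w
    using minimal uK unfolding is_arg_min_def by (meson not_le)
  have op: "open (- {a})" by (rule open_Compl) simp
  have wd: "has_weak_deriv 1 (- {a}) u g"
    unfolding u_def g_def by (rule has_weak_deriv_piecewise_primitive[OF pL pR op]) simp
  have "has_weak_deriv 1 (- {a}) g (\<lambda>x. if a \<le> x then W x * uR x else W x * uL x)"
    unfolding g_def by (rule has_weak_deriv_piecewise_primitive[OF gL gR op]) simp
  moreover have "(\<lambda>x. if a \<le> x then W x * uR x else W x * uL x) = (\<lambda>x. W x * u x)"
    by (auto simp: u_def)
  ultimately have wd2: "has_weak_deriv 2 (- {a}) u (\<lambda>x. W x * u x)"
    using has_weak_deriv_trans[OF wd] by simp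
  have C1: "u C1_differentiable_on (- {a})"
    unfolding C1_differentiable_on_def
  proof (intro exI conjI ballI)
    show "(u has_vector_derivative g x) (at x)" if "x \<in> - {a}" for x
      using du[of x] that by (simp add: has_real_derivative_iff_has_vector_derivative)
    have "continuous_on ({a<..} \<union> {..<a}) g"
    proof (rule continuous_on_open_Un)
      show "continuous_on {a<..} g"
        by (rule continuous_on_eq[OF continuous_on_subset[OF cgR]]) (auto simp: g_def)
      show "continuous_on {..<a} g"
        by (rule continuous_on_eq[OF continuous_on_subset[OF cgL]]) (auto simp: g_def)
    qed auto
    moreover have "{a<..} \<union> {..<a} = - {a}" by auto
    ultimately show "continuous_on (- {a}) g" by simp
  qed
  have uinf: "u \<in> Lp \<infinity> (- {a})"
    by (rule bounded_in_Lp_infinity[OF uL, of _ 1]) (use u0 u1 in \<open>simp add: abs_of_nonneg\<close>)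
  have ginf: "g \<in> Lp \<infinity> (- {a})"
  proof (rule bounded_in_Lp_infinity[OF gL'])
    fix x
    have "sqrt v1 * u x \<le> sqrt v1"
      by (rule mult_left_le[OF u1]) (use v0 v01 in simp)
    with gabs[of x] show "\<bar>g x\<bar> \<le> sqrt v1" by linarith
  qed
  have Wuinf: "(\<lambda>x. W x * u x) \<in> Lp \<infinity> (- {a})"
  proof (rule bounded_in_Lp_infinity)
    show "(\<lambda>x. W x * u x) \<in> borel_measurable lebesgue" using WL uL by measurable
    show "\<bar>W x * u x\<bar> \<le> v1 * 1" for x
      unfolding abs_mult by (intro mult_mono Wabs) (use u0 u1 v0 v01 in \<open>simp_all add: abs_of_nonneg\<close>)
  qed
  have "\<exists>f\<in>Lp \<infinity> (- {a}). has_weak_deriv j (- {a}) u f" if "j \<in> {1..2}" for j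
  proof -
    from that have "j = 1 \<or> j = 2" by auto
    then show ?thesis using wd wd2 ginf Wuinf by blast
  qed
  then have W2: "u \<in> W2inf (- {a})"
    unfolding W2inf_def sobolev_def using C1 uinf by blast
  have "AE x in lebesgue_on (- {a}). V x = W x"
    using VW by (subst AE_restrict_space_iff) (auto elim: eventually_mono)
  with weak_deriv_AE_eq[OF op wd2]
  have eq: "AE x in lebesgue_on (- {a}). weak_deriv 2 (- {a}) u x = V x * u x"
    by eventually_elim simp
  have "sqrt v0 * u x \<le> sgn (a - x) * deriv u x \<and> sgn (a - x) * deriv u x \<le> sqrt v1 * u x" if "x \<noteq> a" for x
    using gb[OF that] DERIV_imp_deriv[OF du[OF that]] by simp
  then show ?thesis
    using argmin W2 eq ub by blast
qed

theorem theorem3p1: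
  fixes V :: "real \<Rightarrow> real" and v0 v1 a :: real
  assumes "V \<in> Lp \<infinity> UNIV"
    and "0 < v0"
    and "AE x in lebesgue. v0 \<le> V x \<and> V x \<le> v1"
  shows "(\<exists>!u. is_arg_min (energy V) (\<lambda>w. w \<in> K a) u) \<and>
    (\<forall>u. is_arg_min (energy V) (\<lambda>w. w \<in> K a) u \<longrightarrow>
       F V a = energy V u \<and>
       (u \<in> W2inf (- {a}) \<and>
        (AE x in lebesgue_on (- {a}). weak_deriv 2 (- {a}) u x = V x * u x)) \<and>
       (\<forall>x. exp (- sqrt v1 * \<bar>x - a\<bar>) \<le> u x \<and> u x \<le> exp (- sqrt v0 * \<bar>x - a\<bar>)) \<and>
       (\<forall>x. x \<noteq> a \<longrightarrow>
          v0 / sqrt v1 * exp (- sqrt v1 * \<bar>x - a\<bar>) \<le> sgn (a - x) * deriv u x \<and>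
          sgn (a - x) * deriv u x \<le> v1 / sqrt v0 * exp (- sqrt v0 * \<bar>x - a\<bar>)) \<and>
       (\<forall>c>0. (AE x in lebesgue. V x = c) \<longrightarrow> (\<forall>x. u x = exp (- sqrt c * \<bar>x - a\<bar>))))"
proof -
  have VL: "V \<in> borel_measurable lebesgue"
    using assms(1) by (simp add: Lp_def lebesgue_on_UNIV_eq)
  obtain u where u: "\<And>w. is_arg_min (energy V) (\<lambda>w. w \<in> K a) w \<longleftrightarrow> w = u"
    and W2: "u \<in> W2inf (- {a})" and ode: "AE x in lebesgue_on (- {a}). weak_deriv 2 (- {a}) u x = V x * u x"
    and ub: "\<And>x. exp (- sqrt v1 * \<bar>x - a\<bar>) \<le> u x" "\<And>x. u x \<le> exp (- sqrt v0 * \<bar>x - a\<bar>)"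
    and db: "\<And>x. x \<noteq> a \<Longrightarrow> sqrt v0 * u x \<le> sgn (a - x) * deriv u x"
      "\<And>x. x \<noteq> a \<Longrightarrow> sgn (a - x) * deriv u x \<le> sqrt v1 * u x"
    using constrained_minimizer[OF VL assms(2,3), of a] by blast
  \<comment> \<open>The bounds at any point other than a order the two rates.\<close>
  have "exp (- sqrt v1 * \<bar>a + 1 - a\<bar>) \<le> exp (- sqrt v0 * \<bar>a + 1 - a\<bar>)"
    using ub order_trans by blast
  then have v01: "sqrt v0 \<le> sqrt v1" by simp
  have s0: "0 < sqrt v0" using assms(2) by simp
  then have s1: "0 < sqrt v1" using v01 by linarith
  have rates: "v0 / sqrt v1 \<le> sqrt v0" "sqrt v1 \<le> v1 / sqrt v0"
  proof -
    have "v0 = sqrt v0 * sqrt v0" "v1 = sqrt v1 * sqrt v1"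
      using s0 s1 by simp_all
    then show "v0 / sqrt v1 \<le> sqrt v0" "sqrt v1 \<le> v1 / sqrt v0"
      using v01 s0 s1 by (metis divide_le_eq mult_left_mono less_imp_le, metis le_divide_eq mult_left_mono less_imp_le)
  qed
  have arg: "is_arg_min (energy V) (\<lambda>w. w \<in> K a) u" using u by simp
  then have uK: "u \<in> K a" and min: "\<And>w. w \<in> K a \<Longrightarrow> energy V u \<le> energy V w"
    unfolding is_arg_min_def by (auto simp: not_less)
  have "F V a = energy V u"
    unfolding F_def by (rule cInf_eq_minimum) (use uK min in auto)
  moreover have "v0 / sqrt v1 * exp (- sqrt v1 * \<bar>x - a\<bar>) \<le> sgn (a - x) * deriv u x \<and>
          sgn (a - x) * deriv u x \<le> v1 / sqrt v0 * exp (- sqrt v0 * \<bar>x - a\<bar>)" if "x \<noteq> a" for x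
  proof
    have "v0 / sqrt v1 * exp (- sqrt v1 * \<bar>x - a\<bar>) \<le> sqrt v0 * u x"
      using s0 by (intro mult_mono rates ub) auto
    then show "v0 / sqrt v1 * exp (- sqrt v1 * \<bar>x - a\<bar>) \<le> sgn (a - x) * deriv u x"
      using db(1)[OF that] by linarith
    have "0 \<le> u x" using ub(1)[of x] by (meson exp_ge_zero order_trans)
    then have "sqrt v1 * u x \<le> v1 / sqrt v0 * exp (- sqrt v0 * \<bar>x - a\<bar>)"
      using s1 order_trans[OF less_imp_le[OF s1] rates(2)] by (intro mult_mono rates ub)
    then show "sgn (a - x) * deriv u x \<le> v1 / sqrt v0 * exp (- sqrt v0 * \<bar>x - a\<bar>)"
      using db(2)[OF that] by linarith
  qed
  moreover have "u x = exp (- sqrt c * \<bar>x - a\<bar>)" if c: "c > 0" "AE x in lebesgue. V x = c" for c x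
  proof -
    have "AE x in lebesgue. c \<le> V x \<and> V x \<le> c"
      using c(2) by eventually_elim simp
    \<comment> \<open>With both bounds equal to c the minimizer is squeezed between equal exponentials.\<close>
    from constrained_minimizer[OF VL c(1) this, of a]
    obtain u' where "is_arg_min (energy V) (\<lambda>w. w \<in> K a) u'"
      "\<And>x. exp (- sqrt c * \<bar>x - a\<bar>) \<le> u' x \<and> u' x \<le> exp (- sqrt c * \<bar>x - a\<bar>)"
      by blast
    then show ?thesis using u by (metis antisym)
  qed
  ultimately show ?thesis
    using u W2 ode ub by auto
qed

end
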